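(* For every initial state (density matrix) $\eta$ on $\mathsf h$ and every $t>0$, the support projection of $\mathcal T_{*t}(\eta)$ (the orthogonal projection onto the closure of its range) is the identity $\mathbb 1$, i.e. the support of $\mathcal T_{*t}(\eta)$ is the whole of $\mathsf h$.
   Context: Let $\mathsf h=\ell^2(\mathbb N)$ with canonical orthonormal basis $(e_n)_{n\ge0}$ and let $N$ be the number operator, $Ne_n=ne_n$. Fix $r>0$ and set $\omega_n=n(n+r-1)$ for $n\ge0$. On $\mathrm{Dom}(N)=\{u=\sum_n u_ne_n:\sum_n n^2|u_n|^2<\infty\}$ define $Be_n=\omega_n^{1/2}e_{n-1}$ for $n\ge1$, $Be_0=0$, and $B^+e_n=\omega_{n+1}^{1/2}e_{n+1}$. Fix real numbers $\lambda,\mu>0$ and $\zeta^+,\zeta^-$. Let $G$ be the operator with domain $\mathrm{Dom}(N^2)$ given by $Ge_n=-\big((\tfrac{\lambda^2}{2}+i\zeta^+)\omega_{n+1}+(\tfrac{\mu^2}{2}+i\zeta^-)\omega_n\big)e_n$, generating the contraction semigroup $P_t=e^{tG}$, and let $L_1=\mu B$, $L_2=\lambda B^+$. The quantum dynamical semigroup $\mathcal T=(\mathcal T_t)_{t\ge0}$ on $\mathcal B(\mathsf h)$ is the minimal quantum dynamical semigroup associated with $G,L_1,L_2$, i.e. the minimal solution of $\langle v,\mathcal T_t(x)u\rangle=\langle P_tv,xP_tu\rangle+\sum_{\ell=1}^2\int_0^t\langle L_\ell P_{t-s}v,\mathcal T_s(x)L_\ell P_{t-s}u\rangle\,ds$ for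 $u,v\in\mathrm{Dom}(G)$, $x\in\mathcal B(\mathsf h)$; its formal generator is $\mathcal L(x)=-\frac{\lambda^2}{2}(BB^+x-2BxB^++xBB^+)-\frac{\mu^2}{2}(B^+Bx-2B^+xB+xB^+B)+i[\zeta^+BB^++\zeta^-B^+B,x]$. $\mathcal T_*=(\mathcal T_{*t})_{t\ge0}$ is the predual semigroup on trace-class operators. *)

theory Defs
  imports "HOL-Analysis.Analysis"
begin

section \<open>The Hilbert space h = l2(N), concretely\<close>

type_synonym vec = "nat \<Rightarrow> complex"
type_synonym op = "vec \<Rightarrow> vec"

definition l2 :: "vec set" where
  "l2 = {u. summable (\<lambda>n. (cmod (u n))\<^sup>2)}"

definition l2norm :: "vec \<Rightarrow> real" where
  "l2norm u = sqrt (\<Sum>n. (cmod (u n))\<^sup>2)"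

text \<open>Inner product, conjugate-linear in the first argument.\<close>
definition inner_l2 :: "vec \<Rightarrow> vec \<Rightarrow> complex" where
  "inner_l2 v u = (\<Sum>n. cnj (v n) * u n)"

text \<open>Canonical orthonormal basis.\<close>
definition basis :: "nat \<Rightarrow> vec" where
  "basis k = (\<lambda>n. if n = k then 1 else 0)"

text \<open>Norm closure inside l2.\<close>
definition l2_closure :: "vec set \<Rightarrow> vec set" where
  "l2_closure S = {u \<in> l2. \<forall>e>0. \<exists>w\<in>S. l2norm (\<lambda>n. u n - w n) < e}"

section \<open>Bounded operators (represented by their action on l2)\<close>

definition bop :: "op \<Rightarrow> bool" where
  "bop A \<longleftrightarrow> (\<forall>u\<in>l2. A u \<in> l2)
     \<and> (\<forall>u\<in>l2. \<forall>w\<in>l2. \<forall>c. A (\<lambda>n. c * u n + w n) = (\<lambda>n. c * A u n + A w n))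
     \<and> (\<exists>C. \<forall>u\<in>l2. l2norm (A u) \<le> C * l2norm u)"

definition opeq :: "op \<Rightarrow> op \<Rightarrow> bool" where
  "opeq A B \<longleftrightarrow> (\<forall>u\<in>l2. A u = B u)"

definition pos_op :: "op \<Rightarrow> bool" where
  "pos_op A \<longleftrightarrow> bop A \<and> (\<forall>u\<in>l2. Im (inner_l2 u (A u)) = 0 \<and> Re (inner_l2 u (A u)) \<ge> 0)"

text \<open>Operator order x <= y.\<close>
definition op_le :: "op \<Rightarrow> op \<Rightarrow> bool" where
  "op_le A B \<longleftrightarrow> (\<forall>u\<in>l2. Im (inner_l2 u (B u) - inner_l2 u (A u)) = 0
                          \<and> Re (inner_l2 u (B u) - inner_l2 u (A u)) \<ge> 0)"

section \<open>Trace class, trace, density_matrix matrices\<close>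

definition hilbert_schmidt :: "op \<Rightarrow> bool" where
  "hilbert_schmidt A \<longleftrightarrow> bop A \<and> summable (\<lambda>n. (l2norm (A (basis n)))\<^sup>2)"

text \<open>Trace class = products of two Hilbert-Schmidt operators.\<close>
definition trace_class :: "op \<Rightarrow> bool" where
  "trace_class A \<longleftrightarrow> bop A \<and> (\<exists>B C. hilbert_schmidt B \<and> hilbert_schmidt C \<and> opeq A (B \<circ> C))"

definition trace :: "op \<Rightarrow> complex" where
  "trace A = (\<Sum>n. inner_l2 (basis n) (A (basis n)))"

text \<open>Density matrix: positive operator with (finite) trace 1.\<close>
definition density_matrix :: "op \<Rightarrow> bool" where
  "density_matrix \<eta> \<longleftrightarrow> pos_op \<eta> \<and> summable (\<lambda>n. inner_l2 (basis n) (\<eta> (basis n)))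
                  \<and> trace \<eta> = 1"

section \<open>The model\<close>

definition omega :: "real \<Rightarrow> nat \<Rightarrow> real" where
  "omega r n = real n * (real n + r - 1)"

text \<open>Domain of G = Dom(N^2).\<close>
definition domG :: "vec set" where
  "domG = {u \<in> l2. summable (\<lambda>n. (real n)^4 * (cmod (u n))\<^sup>2)}"

text \<open>Eigenvalues of the diagonal operator G: G e_n = gval n e_n.\<close>
definition gval :: "real \<Rightarrow> real \<Rightarrow> real \<Rightarrow> real \<Rightarrow> real \<Rightarrow> nat \<Rightarrow> complex" where
  "gval r lam mu zp zm n =
     - ((complex_of_real (lam\<^sup>2 / 2) + \<i> * complex_of_real zp) * complex_of_real (omega r (n + 1))
      + (complex_of_real (mu\<^sup>2 / 2) + \<i> * complex_of_real zm) * complex_of_real (omega r n))"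

text \<open>P_t = exp(tG) (G diagonal).\<close>
definition Psg :: "real \<Rightarrow> real \<Rightarrow> real \<Rightarrow> real \<Rightarrow> real \<Rightarrow> real \<Rightarrow> op" where
  "Psg r lam mu zp zm t u = (\<lambda>n. exp (complex_of_real t * gval r lam mu zp zm n) * u n)"

text \<open>B e_n = sqrt(omega n) e_(n-1), B+ e_n = sqrt(omega (n+1)) e_(n+1).\<close>
definition Bop :: "real \<Rightarrow> op" where
  "Bop r u = (\<lambda>n. complex_of_real (sqrt (omega r (n + 1))) * u (n + 1))"

definition Bplus :: "real \<Rightarrow> op" where
  "Bplus r u = (\<lambda>n. if n = 0 then 0 else complex_of_real (sqrt (omega r n)) * u (n - 1))"

text \<open>L_1 = mu B, L_2 = lam B+.\<close>
definition Lop :: "real \<Rightarrow> real \<Rightarrow> real \<Rightarrow> nat \<Rightarrow> op" where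
  "Lop r lam mu l u = (if l = 1 then (\<lambda>n. complex_of_real mu * Bop r u n)
                        else (\<lambda>n. complex_of_real lam * Bplus r u n))"

section \<open>Minimal quantum dynamical semigroup\<close>

text \<open>A family of positive linear maps on B(h) solving the defining integral equation.\<close>
definition qds_solution ::
  "real \<Rightarrow> real \<Rightarrow> real \<Rightarrow> real \<Rightarrow> real \<Rightarrow> (real \<Rightarrow> op \<Rightarrow> op) \<Rightarrow> bool" where
  "qds_solution r lam mu zp zm T \<longleftrightarrow>
     (\<forall>t\<ge>0. \<forall>x. bop x \<longrightarrow> bop (T t x))
   \<and> (\<forall>t\<ge>0. \<forall>x y. bop x \<longrightarrow> bop y \<longrightarrow> opeq x y \<longrightarrow> opeq (T t x) (T t y))
   \<and> (\<forall>t\<ge>0. \<forall>x y c. bop x \<longrightarrow> bop y \<longrightarrow>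
        opeq (T t (\<lambda>u n. c * x u n + y u n)) (\<lambda>u n. c * T t x u n + T t y u n))
   \<and> (\<forall>t\<ge>0. \<forall>x. pos_op x \<longrightarrow> pos_op (T t x))
   \<and> (\<forall>t\<ge>0. \<forall>x. bop x \<longrightarrow> (\<forall>u\<in>domG. \<forall>v\<in>domG.
        (\<forall>l\<in>{1,2::nat}. set_integrable lborel {0..t}
           (\<lambda>s. inner_l2 (Lop r lam mu l (Psg r lam mu zp zm (t - s) v))
                          (T s x (Lop r lam mu l (Psg r lam mu zp zm (t - s) u)))))
      \<and> inner_l2 v (T t x u) =
          inner_l2 (Psg r lam mu zp zm t v) (x (Psg r lam mu zp zm t u))
          + (\<Sum>l\<in>{1,2::nat}. LINT s:{0..t}|lborel.
               inner_l2 (Lop r lam mu l (Psg r lam mu zp zm (t - s) v))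
                        (T s x (Lop r lam mu l (Psg r lam mu zp zm (t - s) u))))))"

text \<open>The minimal solution: below every positive solution on positive elements.\<close>
definition minimal_qds ::
  "real \<Rightarrow> real \<Rightarrow> real \<Rightarrow> real \<Rightarrow> real \<Rightarrow> (real \<Rightarrow> op \<Rightarrow> op) \<Rightarrow> bool" where
  "minimal_qds r lam mu zp zm T \<longleftrightarrow> qds_solution r lam mu zp zm T
     \<and> (\<forall>T'. qds_solution r lam mu zp zm T' \<longrightarrow>
          (\<forall>t\<ge>0. \<forall>x. pos_op x \<longrightarrow> op_le (T t x) (T' t x)))"

text \<open>rho = T_{*t}(eta): the trace-class operator with tr(rho x) = tr(eta T_t(x)) for all x in B(h).\<close>
definition predual_image :: "(real \<Rightarrow> op \<Rightarrow> op) \<Rightarrow> real \<Rightarrow> op \<Rightarrow> op \<Rightarrow> bool" where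
  "predual_image T t \<eta> \<rho> \<longleftrightarrow> trace_class \<rho> \<and>
     (\<forall>x. bop x \<longrightarrow> trace (\<rho> \<circ> x) = trace (\<eta> \<circ> T t x))"

text \<open>Support of an operator: closure of its range (the support projection projects onto it).\<close>
definition support :: "op \<Rightarrow> vec set" where
  "support A = l2_closure (A ` l2)"

end

theory Submission
  imports Defs "HOL-Complex_Analysis.Complex_Analysis"
begin

text \<open>
  Suppose \<open>v \<noteq> 0\<close> is orthogonal to the range of \<open>\<rho> = T\<^sub>*\<^sub>t(\<eta>)\<close>. Then
  \<open>tr (\<eta> T\<^sub>t(|v><v|)) = <v, \<rho> v> = 0\<close>, and a Cholesky factorisation \<open>\<eta> = \<Sum>\<^sub>k |w\<^sub>k><w\<^sub>k|\<close> yields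
  a vector \<open>w \<noteq> 0\<close> that is null at time \<open>t\<close>, meaning \<open><w, T\<^sub>t(|v><v|) w> = 0\<close>.

  By positivity of all terms in the integral equation, \<open>w\<close> null at time \<open>t\<close> forces
  \<open><v, P\<^sub>t w> = 0\<close> and, for almost every \<open>s \<in> (0, t)\<close>, that \<open>L\<^sub>l P\<^sub>t\<^sub>-\<^sub>s w\<close> is null at time \<open>s\<close>.
  Hence \<open><v, P\<^sub>s B P\<^sub>t\<^sub>-\<^sub>s w> = 0\<close> for almost every \<open>s\<close>. With \<open>\<tau> = t - s\<close> this is a series in
  \<open>exp (\<tau> (g\<^sub>n\<^sub>+\<^sub>1 - g\<^sub>n))\<close>, where \<open>G e\<^sub>n = g\<^sub>n e\<^sub>n\<close>; the exponents have strictly decreasing real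
  parts and lie in a sector, so the series is holomorphic in \<open>\<tau>\<close> and all its coefficients vanish.
  If the \<open>m\<close>-th coordinate of \<open>v\<close> is nonzero, then every null vector has zero \<open>(m+1)\<close>-th
  coordinate, at every time. Passing from \<open>w\<close> to \<open>B P\<^sub>t\<^sub>-\<^sub>s w\<close> or \<open>B\<^sup>+ P\<^sub>t\<^sub>-\<^sub>s w\<close> moves
  this property up or down the ladder, so \<open>w = 0\<close>.
\<close>

section \<open>Square-summable sequences and positive operators\<close>

lemma l2_lincomb:
  assumes "u \<in> l2" "w \<in> l2"
  shows "(\<lambda>n. c * u n + w n) \<in> l2"
proof -
  have "summable (\<lambda>n. 2 * (cmod c)\<^sup>2 * (cmod (u n))\<^sup>2 + 2 * (cmod (w n))\<^sup>2)"
    using assms by (intro summable_add summable_mult) (auto simp: l2_def)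
  moreover have "norm ((cmod (c * u n + w n))\<^sup>2)
      \<le> 2 * (cmod c)\<^sup>2 * (cmod (u n))\<^sup>2 + 2 * (cmod (w n))\<^sup>2" for n
  proof -
    have "(cmod (c * u n + w n))\<^sup>2 \<le> (cmod (c * u n) + cmod (w n))\<^sup>2"
      by (intro power_mono norm_triangle_ineq norm_ge_zero)
    also have "\<dots> \<le> 2 * (cmod (c * u n))\<^sup>2 + 2 * (cmod (w n))\<^sup>2"
      using sum_squares_bound[of "cmod (c * u n)" "cmod (w n)"] by (simp add: power2_sum)
    finally show ?thesis by (simp add: norm_mult power_mult_distrib)
  qed
  ultimately show ?thesis
    unfolding l2_def mem_Collect_eq by (rule summable_comparison_test')
qed

lemma l2_zero [simp]: "(\<lambda>n. 0) \<in> l2"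
  by (simp add: l2_def)

lemma l2_scale: "u \<in> l2 \<Longrightarrow> (\<lambda>n. c * u n) \<in> l2"
  using l2_lincomb[of u "\<lambda>n. 0" c] by simp

lemma l2_add: "u \<in> l2 \<Longrightarrow> w \<in> l2 \<Longrightarrow> (\<lambda>n. u n + w n) \<in> l2"
  using l2_lincomb[of u w 1] by simp

lemma l2_diff: "u \<in> l2 \<Longrightarrow> w \<in> l2 \<Longrightarrow> (\<lambda>n. u n - w n) \<in> l2"
  using l2_lincomb[of w u "-1"] by simp

lemma l2_finite_support:
  assumes "\<And>n. n \<ge> N \<Longrightarrow> u n = 0"
  shows "u \<in> l2"
  unfolding l2_def mem_Collect_eq
  by (rule summable_finite[of "{..<N}"]) (auto simp: assms not_less)

lemma basis_same: "basis k k = 1"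
  by (simp add: basis_def)

lemma basis_in_l2 [simp]: "basis k \<in> l2"
  by (rule l2_finite_support[of "Suc k"]) (simp add: basis_def)

section \<open>Inner product and norm on \<open>l2\<close>\<close>

lemma summable_inner:
  assumes "v \<in> l2" "u \<in> l2"
  shows "summable (\<lambda>n. norm (cnj (v n) * u n))"
proof (rule summable_comparison_test)
  show "summable (\<lambda>n. (cmod (v n))\<^sup>2 + (cmod (u n))\<^sup>2)"
    using assms by (intro summable_add) (auto simp: l2_def)
  have "norm (norm (cnj (v n) * u n)) \<le> (cmod (v n))\<^sup>2 + (cmod (u n))\<^sup>2" for n
  proof -
    have "cmod (v n) * cmod (u n) \<le> 2 * cmod (v n) * cmod (u n)" by simp
    also have "\<dots> \<le> (cmod (v n))\<^sup>2 + (cmod (u n))\<^sup>2"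
      by (rule sum_squares_bound)
    finally show ?thesis by (simp add: norm_mult)
  qed
  then show "\<exists>N. \<forall>n\<ge>N. norm (norm (cnj (v n) * u n)) \<le> (cmod (v n))\<^sup>2 + (cmod (u n))\<^sup>2"
    by blast
qed

lemma inner_sums:
  "v \<in> l2 \<Longrightarrow> u \<in> l2 \<Longrightarrow> (\<lambda>n. cnj (v n) * u n) sums inner_l2 v u"
  unfolding inner_l2_def by (rule summable_sums[OF summable_norm_cancel[OF summable_inner]])

lemma inner_lincomb_right:
  assumes "y \<in> l2" "u \<in> l2" "w \<in> l2"
  shows "inner_l2 y (\<lambda>n. c * u n + w n) = c * inner_l2 y u + inner_l2 y w"
proof -
  have "(\<lambda>n. c * (cnj (y n) * u n) + cnj (y n) * w n) sums (c * inner_l2 y u + inner_l2 y w)"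
    using assms by (intro sums_add sums_mult inner_sums)
  moreover have "(\<lambda>n. cnj (y n) * (c * u n + w n)) sums inner_l2 y (\<lambda>n. c * u n + w n)"
    using assms by (intro inner_sums l2_lincomb)
  ultimately show ?thesis
    by (simp add: algebra_simps sums_iff)
qed

lemma inner_cnj: "v \<in> l2 \<Longrightarrow> u \<in> l2 \<Longrightarrow> cnj (inner_l2 v u) = inner_l2 u v"
  using bounded_linear.sums[OF bounded_linear_cnj inner_sums[of v u]] inner_sums[of u v]
  by (simp add: sums_iff mult.commute)

lemma inner_lincomb_left:
  assumes "y \<in> l2" "u \<in> l2" "w \<in> l2"
  shows "inner_l2 (\<lambda>n. c * u n + w n) y = cnj c * inner_l2 u y + inner_l2 w y"
proof -
  have "inner_l2 (\<lambda>n. c * u n + w n) y = cnj (inner_l2 y (\<lambda>n. c * u n + w n))"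
    using assms by (simp add: inner_cnj l2_lincomb)
  also have "\<dots> = cnj c * cnj (inner_l2 y u) + cnj (inner_l2 y w)"
    using assms by (simp add: inner_lincomb_right)
  finally show ?thesis
    using assms by (simp add: inner_cnj)
qed

lemma inner_zero_right [simp]: "inner_l2 u (\<lambda>n. 0) = 0"
  by (simp add: inner_l2_def)

lemma inner_zero_left [simp]: "inner_l2 (\<lambda>n. 0) u = 0"
  by (simp add: inner_l2_def)

lemma inner_scale_right:
  "y \<in> l2 \<Longrightarrow> u \<in> l2 \<Longrightarrow> inner_l2 y (\<lambda>n. c * u n) = c * inner_l2 y u"
  using inner_lincomb_right[of y u "\<lambda>n. 0" c] by simp

lemma inner_scale_left:
  "y \<in> l2 \<Longrightarrow> u \<in> l2 \<Longrightarrow> inner_l2 (\<lambda>n. c * u n) y = cnj c * inner_l2 u y"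
  using inner_lincomb_left[of y u "\<lambda>n. 0" c] by simp

lemma inner_diff_left:
  "y \<in> l2 \<Longrightarrow> u \<in> l2 \<Longrightarrow> w \<in> l2 \<Longrightarrow> inner_l2 (\<lambda>n. u n - w n) y = inner_l2 u y - inner_l2 w y"
  using inner_lincomb_left[of y w u "-1"] by simp

lemma inner_basis_left [simp]: "inner_l2 (basis k) u = u k"
proof -
  have "(\<lambda>n. cnj (basis k n) * u n) = (\<lambda>n. if n = k then u n else 0)"
    by (auto simp: basis_def)
  then show ?thesis
    unfolding inner_l2_def using sums_single[of k u] by (simp add: sums_iff)
qed

lemma inner_basis_right [simp]: "inner_l2 u (basis k) = cnj (u k)"
proof -
  have "(\<lambda>n. cnj (u n) * basis k n) = (\<lambda>n. if n = k then cnj (u n) else 0)"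
    by (auto simp: basis_def)
  then show ?thesis
    unfolding inner_l2_def using sums_single[of k "\<lambda>n. cnj (u n)"] by (simp add: sums_iff)
qed

lemma l2norm_nonneg [simp]: "u \<in> l2 \<Longrightarrow> l2norm u \<ge> 0"
  unfolding l2norm_def l2_def by (auto intro: suminf_nonneg)

lemma l2norm_power2: "u \<in> l2 \<Longrightarrow> (l2norm u)\<^sup>2 = (\<Sum>n. (cmod (u n))\<^sup>2)"
  unfolding l2norm_def l2_def by (simp add: suminf_nonneg)

lemma inner_self: "u \<in> l2 \<Longrightarrow> inner_l2 u u = complex_of_real ((l2norm u)\<^sup>2)"
proof -
  assume u: "u \<in> l2"
  then have "(\<lambda>n. (cmod (u n))\<^sup>2) sums (l2norm u)\<^sup>2"
    by (simp add: l2norm_power2 l2_def summable_sums)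
  from sums_of_real[OF this, where 'a = complex] have "(\<lambda>n. cnj (u n) * u n) sums complex_of_real ((l2norm u)\<^sup>2)"
    by (simp add: complex_norm_square mult.commute del: of_real_power)
  then show ?thesis
    unfolding inner_l2_def by (simp add: sums_iff)
qed

section \<open>Bounded operators and the quadratic forms of positive operators\<close>

lemma bop_l2: "bop A \<Longrightarrow> u \<in> l2 \<Longrightarrow> A u \<in> l2"
  by (simp add: bop_def)

lemma bop_lincomb:
  "bop A \<Longrightarrow> u \<in> l2 \<Longrightarrow> w \<in> l2 \<Longrightarrow> A (\<lambda>n. c * u n + w n) = (\<lambda>n. c * A u n + A w n)"
  by (simp add: bop_def)

lemma bop_zero: "bop A \<Longrightarrow> A (\<lambda>n. 0) = (\<lambda>n. 0)"
  using bop_lincomb[of A "\<lambda>n. 0" "\<lambda>n. 0" 1] by (simp add: fun_eq_iff)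

lemma bop_scale: "bop A \<Longrightarrow> u \<in> l2 \<Longrightarrow> A (\<lambda>n. c * u n) = (\<lambda>n. c * A u n)"
  using bop_lincomb[of A u "\<lambda>n. 0" c] bop_zero[of A] by simp

lemma bop_bound:
  assumes "bop A"
  obtains C where "C \<ge> 0" "\<And>u. u \<in> l2 \<Longrightarrow> l2norm (A u) \<le> C * l2norm u"
proof -
  obtain C where C: "\<And>u. u \<in> l2 \<Longrightarrow> l2norm (A u) \<le> C * l2norm u"
    using assms unfolding bop_def by blast
  have "l2norm (A u) \<le> max C 0 * l2norm u" if "u \<in> l2" for u
    by (rule order_trans[OF C[OF that]]) (simp add: mult_right_mono that)
  then show ?thesis
    using that[of "max C 0"] by simp
qed

lemma pos_op_bop: "pos_op A \<Longrightarrow> bop A"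
  by (simp add: pos_op_def)

lemma pos_op_nonneg: "pos_op A \<Longrightarrow> u \<in> l2 \<Longrightarrow> Re (inner_l2 u (A u)) \<ge> 0"
  by (simp add: pos_op_def)

lemma pos_op_real: "pos_op A \<Longrightarrow> u \<in> l2 \<Longrightarrow> Im (inner_l2 u (A u)) = 0"
  by (simp add: pos_op_def)

lemma cmod_square: "(cmod z)\<^sup>2 = Re z * Re z + Im z * Im z"
  unfolding cmod_power2 by (simp add: power2_eq_square)

lemma bop_form_expand:
  assumes "bop A" "u \<in> l2" "w \<in> l2"
  shows "inner_l2 (\<lambda>n. c * u n + w n) (A (\<lambda>n. c * u n + w n)) =
    cnj c * c * inner_l2 u (A u) + cnj c * inner_l2 u (A w) + c * inner_l2 w (A u) + inner_l2 w (A w)"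
  using assms
  by (simp add: bop_lincomb inner_lincomb_left inner_lincomb_right bop_l2 l2_lincomb)
     (simp add: algebra_simps)

text \<open>Polarisation: the form is real at \<open>c * u + w\<close> for every scalar
  \<open>c\<close>, so the cross terms have zero imaginary part. The choice \<open>c = 1\<close>
  matches the imaginary parts of the two sides, and \<open>c = \<i>\<close> the real parts.\<close>

lemma pos_op_hermitian:
  assumes A: "pos_op A" and u: "u \<in> l2" and w: "w \<in> l2"
  shows "inner_l2 u (A w) = inner_l2 (A u) w"
proof -
  note bA = pos_op_bop[OF A]
  have "Im (cnj c * inner_l2 u (A w) + c * inner_l2 w (A u)) = 0" for c
    using pos_op_real[OF A l2_lincomb[OF u w, of c]] pos_op_real[OF A u] pos_op_real[OF A w]
    unfolding bop_form_expand[OF bA u w] by (simp add: algebra_simps)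
  from this[of 1] this[of \<i>] have "inner_l2 u (A w) = cnj (inner_l2 w (A u))"
    by (simp add: complex_eq_iff)
  then show ?thesis
    using inner_cnj[OF w bop_l2[OF bA u]] by simp
qed

text \<open>The form is nonnegative at \<open>c * u + w\<close> for every \<open>c\<close>, and the
  bound comes from the best \<open>c\<close>. As the form is only semidefinite, it may vanish at
  \<open>u\<close>; the expression is then affine in \<open>c\<close> and is treated
  separately.\<close>

lemma pos_op_Cauchy_Schwarz:
  assumes A: "pos_op A" and u: "u \<in> l2" and w: "w \<in> l2"
  shows "(cmod (inner_l2 w (A u)))\<^sup>2 \<le> Re (inner_l2 u (A u)) * Re (inner_l2 w (A w))"
proof -
  note bA = pos_op_bop[OF A]
  define a b z where "a = Re (inner_l2 u (A u))" and "b = Re (inner_l2 w (A w))"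
    and "z = inner_l2 w (A u)"
  have uw: "inner_l2 u (A w) = cnj z"
    using pos_op_hermitian[OF A u w] inner_cnj[OF w bop_l2[OF bA u]] by (simp add: z_def)
  have nonneg: "(cmod c)\<^sup>2 * a + 2 * Re (c * z) + b \<ge> 0" for c
    using pos_op_nonneg[OF A l2_lincomb[OF u w, of c]] pos_op_real[OF A u]
    unfolding bop_form_expand[OF bA u w] uw
    by (simp add: a_def b_def cmod_square algebra_simps flip: z_def)
  have a0: "a \<ge> 0"
    using pos_op_nonneg[OF A u] by (simp add: a_def)
  have Re_eq: "Re (complex_of_real k * cnj z * z) = k * (cmod z)\<^sup>2" for k
    by (simp add: cmod_square algebra_simps)
  show ?thesis
  proof (cases "a = 0")
    case True
    have "z = 0"
    proof (rule ccontr)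
      assume "z \<noteq> 0"
      then have pos: "(cmod z)\<^sup>2 > 0" by simp
      \<comment> \<open>For \<open>a = 0\<close> this multiple of \<open>cnj z\<close> brings the
        expression down to \<open>- b - 2\<close>, which is negative.\<close>
      have "2 * (- (b + 1) / (cmod z)\<^sup>2 * (cmod z)\<^sup>2) + b \<ge> 0"
        using nonneg[of "complex_of_real (- (b + 1) / (cmod z)\<^sup>2) * cnj z"] True
        unfolding Re_eq by simp
      then have "- 2 * (b + 1) + b \<ge> 0"
        using pos by simp
      moreover have "b \<ge> 0"
        using pos_op_nonneg[OF A w] by (simp add: b_def)
      ultimately show False by simp
    qed
    then show ?thesis
      using True by (simp flip: z_def a_def b_def)
  next
    case False
    then have a: "a > 0" using a0 by simp
    \<comment> \<open>The scalar \<open>- cnj z / a\<close> minimises the quadratic expression in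
      \<open>c\<close>.\<close>
    have "(cmod (complex_of_real (- 1 / a) * cnj z))\<^sup>2 * a + 2 * (- 1 / a * (cmod z)\<^sup>2) + b \<ge> 0"
      using nonneg[of "complex_of_real (- 1 / a) * cnj z"] unfolding Re_eq .
    moreover have "(cmod (complex_of_real (- 1 / a) * cnj z))\<^sup>2 * a = (cmod z)\<^sup>2 / a"
      using a by (simp add: norm_mult norm_divide power_mult_distrib power_divide power2_eq_square)
    ultimately have "(cmod z)\<^sup>2 / a \<le> b" by simp
    then show ?thesis
      using a by (simp add: field_simps flip: z_def a_def b_def)
  qed
qed

text \<open>Feeding the identity into the inequality for positive operators yields the
  Cauchy-Schwarz inequality of \<open>l2\<close> itself.\<close>

lemma pos_op_id: "pos_op (\<lambda>u. u)"
  unfolding pos_op_def bop_def by (auto simp: inner_self intro!: l2_lincomb exI[of _ 1])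

lemma l2_Cauchy_Schwarz:
  assumes "w \<in> l2" "u \<in> l2"
  shows "cmod (inner_l2 w u) \<le> l2norm w * l2norm u"
proof (rule power2_le_imp_le)
  show "(cmod (inner_l2 w u))\<^sup>2 \<le> (l2norm w * l2norm u)\<^sup>2"
    using pos_op_Cauchy_Schwarz[OF pos_op_id assms(2,1)] assms
    by (simp add: inner_self power_mult_distrib mult.commute del: of_real_power)
qed (use assms in simp)

lemma l2norm_lincomb_power2:
  assumes "u \<in> l2" "w \<in> l2"
  shows "(l2norm (\<lambda>n. c * u n + w n))\<^sup>2 =
    (cmod c)\<^sup>2 * (l2norm u)\<^sup>2 + 2 * Re (c * inner_l2 w u) + (l2norm w)\<^sup>2"
proof -
  have "bop (\<lambda>u. u)" using pos_op_id by (rule pos_op_bop)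
  from arg_cong[OF bop_form_expand[OF this assms, of c], of Re]
  show ?thesis
    unfolding inner_cnj[OF assms(2,1), symmetric] inner_self[OF l2_lincomb[OF assms]]
      inner_self[OF assms(1)] inner_self[OF assms(2)]
    by (simp add: cmod_square algebra_simps del: of_real_power)
qed

lemma l2norm_triangle:
  assumes "u \<in> l2" "w \<in> l2"
  shows "l2norm (\<lambda>n. u n + w n) \<le> l2norm u + l2norm w"
proof (rule power2_le_imp_le)
  have "Re (inner_l2 w u) \<le> l2norm u * l2norm w"
    using complex_Re_le_cmod[of "inner_l2 w u"] l2_Cauchy_Schwarz[OF assms(2,1)]
    by (simp add: mult.commute)
  then show "(l2norm (\<lambda>n. u n + w n))\<^sup>2 \<le> (l2norm u + l2norm w)\<^sup>2"
    using l2norm_lincomb_power2[OF assms, of 1] by (simp add: power2_sum)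
qed (use assms in simp)

lemma l2norm_scale: "u \<in> l2 \<Longrightarrow> l2norm (\<lambda>n. c * u n) = cmod c * l2norm u"
  using l2norm_lincomb_power2[of u "\<lambda>n. 0" c] l2_scale[of u c]
  by (simp add: l2norm_def[of "\<lambda>n. 0"] flip: power_mult_distrib)

lemma l2norm_basis [simp]: "l2norm (basis n) = 1"
proof -
  have "(l2norm (basis n))\<^sup>2 = 1"
    using inner_self[of "basis n"] basis_same[of n] by (simp add: complex_eq_iff)
  then show ?thesis
    using l2norm_nonneg[OF basis_in_l2[of n]] by (auto simp: power2_eq_1_iff)
qed

lemma l2_coord_le: "u \<in> l2 \<Longrightarrow> cmod (u n) \<le> l2norm u"
  using l2_Cauchy_Schwarz[of "basis n" u] by simp

text \<open>With \<open>e j = uj j - u\<close>, the difference of the two values consists of terms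
  linear or quadratic in \<open>e j\<close>, each controlled by \<open>l2norm (e j)\<close> and the
  bound of \<open>A\<close>.\<close>

lemma form_tendsto:
  assumes A: "bop A" and u: "u \<in> l2" and uj: "\<And>j. uj j \<in> l2"
    and lim: "(\<lambda>j. l2norm (\<lambda>n. uj j n - u n)) \<longlonglongrightarrow> 0"
  shows "(\<lambda>j. inner_l2 (uj j) (A (uj j))) \<longlonglongrightarrow> inner_l2 u (A u)"
proof -
  obtain C where C: "C \<ge> 0" "\<And>u. u \<in> l2 \<Longrightarrow> l2norm (A u) \<le> C * l2norm u"
    by (rule bop_bound[OF A]) blast
  define e where "e j = (\<lambda>n. uj j n - u n)" for j
  have e: "e j \<in> l2" for j
    unfolding e_def by (intro l2_diff uj u)
  have form_eq: "inner_l2 (uj j) (A (uj j)) - inner_l2 u (A u) =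
      inner_l2 (e j) (A (e j)) + inner_l2 (e j) (A u) + inner_l2 u (A (e j))" for j
    using bop_form_expand[OF A e u, of 1] by (simp add: e_def)
  have bound: "norm (inner_l2 (uj j) (A (uj j)) - inner_l2 u (A u)) \<le>
      l2norm (e j) * (C * l2norm (e j)) + 2 * C * l2norm u * l2norm (e j)" for j
  proof -
    have "cmod (inner_l2 (e j) (A (e j))) \<le> l2norm (e j) * (C * l2norm (e j))"
      by (rule order_trans[OF l2_Cauchy_Schwarz]) (auto intro!: mult_left_mono C l2norm_nonneg e u bop_l2[OF A])
    moreover have "cmod (inner_l2 (e j) (A u)) \<le> l2norm (e j) * (C * l2norm u)"
      by (rule order_trans[OF l2_Cauchy_Schwarz]) (auto intro!: mult_left_mono C l2norm_nonneg e u bop_l2[OF A])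
    moreover have "cmod (inner_l2 u (A (e j))) \<le> l2norm u * (C * l2norm (e j))"
      by (rule order_trans[OF l2_Cauchy_Schwarz]) (auto intro!: mult_left_mono C l2norm_nonneg e u bop_l2[OF A])
    ultimately show ?thesis
      unfolding form_eq
      using norm_triangle_ineq[of "inner_l2 (e j) (A (e j)) + inner_l2 (e j) (A u)" "inner_l2 u (A (e j))"]
        norm_triangle_ineq[of "inner_l2 (e j) (A (e j))" "inner_l2 (e j) (A u)"]
      by (simp add: algebra_simps)
  qed
  have "(\<lambda>j. l2norm (e j)) \<longlonglongrightarrow> 0"
    using lim by (simp add: e_def)
  then have "(\<lambda>j. l2norm (e j) * (C * l2norm (e j)) + 2 * C * l2norm u * l2norm (e j)) \<longlonglongrightarrow>
      0 * (C * 0) + 2 * C * l2norm u * 0"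
    by (intro tendsto_intros)
  then have "(\<lambda>j. inner_l2 (uj j) (A (uj j)) - inner_l2 u (A u)) \<longlonglongrightarrow> 0"
    by (intro Lim_null_comparison[OF always_eventually[OF allI, OF bound]]) simp
  then show ?thesis
    by (rule LIM_zero_cancel)
qed

section \<open>Orthogonal vectors and rank-one operators\<close>

text \<open>Coordinatewise limits exist because coordinates are bounded by the norm; the norm
  estimates pass to the limit on finite partial sums and from there to the whole series.\<close>

lemma l2_complete:
  assumes z: "\<And>i. z i \<in> l2"
    and cauchy: "\<And>e. e > 0 \<Longrightarrow> \<exists>M. \<forall>i\<ge>M. \<forall>j\<ge>M. l2norm (\<lambda>n. z i n - z j n) < e"
  obtains x where "x \<in> l2" "(\<lambda>i. l2norm (\<lambda>n. z i n - x n)) \<longlonglongrightarrow> 0"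
proof -
  have "Cauchy (\<lambda>i. z i n)" for n
  proof (rule CauchyI)
    fix e :: real assume "e > 0"
    then obtain M where M: "\<And>i j. i \<ge> M \<Longrightarrow> j \<ge> M \<Longrightarrow> l2norm (\<lambda>n. z i n - z j n) < e"
      using cauchy by blast
    have "norm (z i n - z j n) < e" if "i \<ge> M" "j \<ge> M" for i j
      using l2_coord_le[OF l2_diff[OF z[of i] z[of j]], of n] M[OF that] by simp
    then show "\<exists>M. \<forall>i\<ge>M. \<forall>j\<ge>M. norm (z i n - z j n) < e" by blast
  qed
  then have "\<exists>l. (\<lambda>i. z i n) \<longlonglongrightarrow> l" for n
    by (simp add: Cauchy_convergent_iff convergent_def)
  then obtain x where x: "\<And>n. (\<lambda>i. z i n) \<longlonglongrightarrow> x n" by metis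
  have tail: "\<exists>M. \<forall>i\<ge>M. (\<lambda>n. z i n - x n) \<in> l2 \<and> l2norm (\<lambda>n. z i n - x n) \<le> e" if e: "e > 0" for e
  proof -
    obtain M where M: "\<And>i j. i \<ge> M \<Longrightarrow> j \<ge> M \<Longrightarrow> l2norm (\<lambda>n. z i n - z j n) < e"
      using cauchy[OF e] by blast
    have "(\<lambda>n. z i n - x n) \<in> l2 \<and> l2norm (\<lambda>n. z i n - x n) \<le> e" if i: "i \<ge> M" for i
    proof -
      have partial: "(\<Sum>n<N. (cmod (z i n - x n))\<^sup>2) \<le> e\<^sup>2" for N
      proof (rule tendsto_upperbound)
        show "(\<lambda>j. \<Sum>n<N. (cmod (z i n - z j n))\<^sup>2) \<longlonglongrightarrow> (\<Sum>n<N. (cmod (z i n - x n))\<^sup>2)"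
          by (intro tendsto_intros x)
        have "(\<Sum>n<N. (cmod (z i n - z j n))\<^sup>2) \<le> e\<^sup>2" if j: "j \<ge> M" for j
        proof -
          have d: "(\<lambda>n. z i n - z j n) \<in> l2" by (intro l2_diff z)
          then have "(\<Sum>n<N. (cmod (z i n - z j n))\<^sup>2) \<le> (l2norm (\<lambda>n. z i n - z j n))\<^sup>2"
            unfolding l2norm_power2[OF d] by (intro sum_le_suminf) (auto simp: l2_def)
          also have "\<dots> \<le> e\<^sup>2"
            using M[OF i j] l2norm_nonneg[OF d] by (intro power_mono) auto
          finally show ?thesis .
        qed
        then show "\<forall>\<^sub>F j in sequentially. (\<Sum>n<N. (cmod (z i n - z j n))\<^sup>2) \<le> e\<^sup>2"
          by (rule eventually_sequentiallyI)
      qed simp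
      have summ: "summable (\<lambda>n. (cmod (z i n - x n))\<^sup>2)"
        by (rule summableI_nonneg_bounded[OF _ partial]) simp
      then have mem: "(\<lambda>n. z i n - x n) \<in> l2" by (simp add: l2_def)
      have "(l2norm (\<lambda>n. z i n - x n))\<^sup>2 \<le> e\<^sup>2"
        unfolding l2norm_power2[OF mem] by (rule suminf_le_const[OF summ partial])
      then have "l2norm (\<lambda>n. z i n - x n) \<le> e"
        by (rule power2_le_imp_le) (use e in simp)
      with mem show ?thesis by simp
    qed
    then show ?thesis by blast
  qed
  obtain i where "(\<lambda>n. z i n - x n) \<in> l2"
    using tail[of 1] by auto
  from l2_diff[OF z[of i] this] have xl2: "x \<in> l2" by simp
  have "(\<lambda>i. l2norm (\<lambda>n. z i n - x n)) \<longlonglongrightarrow> 0"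
  proof (rule LIMSEQ_I)
    fix e :: real assume "e > 0"
    then obtain M where M: "\<And>i. i \<ge> M \<Longrightarrow> l2norm (\<lambda>n. z i n - x n) \<le> e / 2"
      using tail[of "e / 2"] by auto
    have "norm (l2norm (\<lambda>n. z i n - x n) - 0) < e" if "i \<ge> M" for i
      using M[OF that] \<open>e > 0\<close> l2norm_nonneg[OF l2_diff[OF z xl2]] by simp
    then show "\<exists>M. \<forall>i\<ge>M. norm (l2norm (\<lambda>n. z i n - x n) - 0) < e" by blast
  qed
  with xl2 show ?thesis by (rule that)
qed

lemma l2norm_parallelogram:
  assumes "u \<in> l2" "w \<in> l2"
  shows "(l2norm (\<lambda>n. u n - w n))\<^sup>2 + (l2norm (\<lambda>n. u n + w n))\<^sup>2 = 2 * (l2norm u)\<^sup>2 + 2 * (l2norm w)\<^sup>2"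
  using l2norm_lincomb_power2[OF assms, of 1] l2norm_lincomb_power2[OF assms(2,1), of "-1"]
    inner_cnj[OF assms]
  by (auto simp: complex_eq_iff)

lemma inner_tendsto_left:
  assumes x: "x \<in> l2" and z: "\<And>i. z i \<in> l2" and w: "w \<in> l2"
    and lim: "(\<lambda>i. l2norm (\<lambda>n. z i n - x n)) \<longlonglongrightarrow> 0"
  shows "(\<lambda>i. inner_l2 (z i) w) \<longlonglongrightarrow> inner_l2 x w"
proof (rule LIM_zero_cancel, rule Lim_null_comparison)
  show "\<forall>\<^sub>F i in sequentially. norm (inner_l2 (z i) w - inner_l2 x w) \<le> l2norm (\<lambda>n. z i n - x n) * l2norm w"
    using l2_Cauchy_Schwarz[OF l2_diff[OF z x] w] inner_diff_left[OF w z x] by simp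
  show "(\<lambda>i. l2norm (\<lambda>n. z i n - x n) * l2norm w) \<longlonglongrightarrow> 0"
    using tendsto_mult_right[OF lim, of "l2norm w"] by simp
qed

text \<open>The projection theorem, run on residuals: for a sequence \<open>w i\<close> in
  \<open>S\<close> minimising the distance to \<open>u\<close>, the vectors
  \<open>z i = u - w i\<close> are Cauchy by the parallelogram law, and their limit \<open>x\<close>
  is orthogonal to \<open>S\<close>.\<close>

lemma not_dense_imp_orthogonal:
  assumes S: "S \<subseteq> l2" "(\<lambda>n. 0) \<in> S" "\<And>c a b. a \<in> S \<Longrightarrow> b \<in> S \<Longrightarrow> (\<lambda>n. c * a n + b n) \<in> S"
    and u: "u \<in> l2" "u \<notin> l2_closure S"
  obtains v where "v \<in> l2" "\<exists>m. v m \<noteq> 0" "\<And>w. w \<in> S \<Longrightarrow> inner_l2 v w = 0"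
proof -
  define D where "D = (\<lambda>w. (l2norm (\<lambda>n. u n - w n))\<^sup>2) ` S"
  define d where "d = Inf D"
  have bdd: "bdd_below D"
    by (rule bdd_belowI[of _ 0]) (auto simp: D_def)
  have d_le: "d \<le> (l2norm (\<lambda>n. u n - w n))\<^sup>2" if "w \<in> S" for w
    unfolding d_def by (rule cInf_lower[OF _ bdd]) (use that in \<open>auto simp: D_def\<close>)
  have d_le': "d \<le> (l2norm y)\<^sup>2" if "w \<in> S" "y = (\<lambda>n. u n - w n)" for w y
    using d_le that by simp
  have "\<exists>w\<in>S. (l2norm (\<lambda>n. u n - w n))\<^sup>2 < d + 1 / real (Suc i)" for i
  proof -
    have "D \<noteq> {}" using S(2) by (auto simp: D_def)
    then have "\<exists>y\<in>D. y < d + 1 / real (Suc i)"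
      unfolding d_def by (intro cInf_lessD) auto
    then show ?thesis by (auto simp: D_def)
  qed
  then obtain w where w: "\<And>i. w i \<in> S"
    and w_less: "\<And>i. (l2norm (\<lambda>n. u n - w i n))\<^sup>2 < d + 1 / real (Suc i)"
    by metis
  define z where "z i = (\<lambda>n. u n - w i n)" for i
  have wl2: "w i \<in> l2" for i using w S(1) by blast
  have z: "z i \<in> l2" for i unfolding z_def by (intro l2_diff u wl2)
  have z_less: "(l2norm (z i))\<^sup>2 < d + 1 / real (Suc i)" for i
    using w_less by (simp add: z_def)
  have z_diff: "(l2norm (\<lambda>n. z i n - z j n))\<^sup>2 \<le> 2 / real (Suc i) + 2 / real (Suc j)" for i j
  proof -
    \<comment> \<open>The midpoint of \<open>w i\<close> and \<open>w j\<close>, written with a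
      trailing \<open>0\<close> so that closure under \<open>c * a + b\<close> applies
      twice.\<close>
    have mid: "(\<lambda>n. 1/2 * w i n + (1/2 * w j n + 0)) \<in> S"
      by (intro S(3) w S(2))
    have "d \<le> (l2norm (\<lambda>n. 1/2 * (z i n + z j n)))\<^sup>2"
      by (rule d_le'[OF mid]) (simp add: z_def field_simps)
    also have "\<dots> = (l2norm (\<lambda>n. z i n + z j n))\<^sup>2 / 4"
      unfolding l2norm_scale[OF l2_add[OF z z]] by (simp add: power_divide)
    finally show ?thesis
      using l2norm_parallelogram[OF z[of i] z[of j]] z_less[of i] z_less[of j] by simp
  qed
  obtain x where x: "x \<in> l2" and lim: "(\<lambda>i. l2norm (\<lambda>n. z i n - x n)) \<longlonglongrightarrow> 0"
  proof (rule l2_complete[of z])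
    show "z i \<in> l2" for i by (rule z)
    fix e :: real assume e: "e > 0"
    then obtain M where M: "4 / e\<^sup>2 < real M"
      using reals_Archimedean2 by blast
    have "l2norm (\<lambda>n. z i n - z j n) < e" if ij: "i \<ge> M" "j \<ge> M" for i j
    proof (rule power2_less_imp_less)
      have eM: "4 / real (Suc M) < e\<^sup>2"
      proof -
        have "4 < real M * e\<^sup>2"
          using M e by (simp add: pos_divide_less_eq)
        also have "\<dots> \<le> real (Suc M) * e\<^sup>2"
          by (simp add: mult_right_mono)
        finally show ?thesis
          by (simp add: pos_divide_less_eq mult.commute)
      qed
      have "2 / real (Suc i) \<le> 2 / real (Suc M)" "2 / real (Suc j) \<le> 2 / real (Suc M)"
        using ij by (auto intro!: divide_left_mono)
      then have "(l2norm (\<lambda>n. z i n - z j n))\<^sup>2 \<le> 2 / real (Suc M) + 2 / real (Suc M)"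
        using z_diff[of i j] by linarith
      also have "\<dots> = 4 / real (Suc M)"
        unfolding add_divide_distrib[symmetric] by simp
      also have "\<dots> < e\<^sup>2" by (rule eM)
      finally show "(l2norm (\<lambda>n. z i n - z j n))\<^sup>2 < e\<^sup>2" .
    qed (use e in simp)
    then show "\<exists>M. \<forall>i\<ge>M. \<forall>j\<ge>M. l2norm (\<lambda>n. z i n - z j n) < e" by blast
  qed
  have orth: "inner_l2 x s = 0" if s: "s \<in> S" for s
  proof -
    have sl2: "s \<in> l2" using s S(1) by blast
    show ?thesis
    proof (cases "l2norm s = 0")
      case True
      have "cmod (inner_l2 x s) \<le> l2norm x * l2norm s"
        by (rule l2_Cauchy_Schwarz[OF x sl2])
      then show ?thesis using True by simp
    next
      case False
      define k where "k = (l2norm s)\<^sup>2"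
      have k: "k > 0" using False by (simp add: k_def)
      have small: "(cmod (inner_l2 (z i) s))\<^sup>2 \<le> k / real (Suc i)" for i
      proof -
        define p where "p = inner_l2 (z i) s"
        \<comment> \<open>This \<open>c\<close> minimises the norm of \<open>c * s + z i\<close>.
          The squared norm drops by \<open>(cmod p)\<^sup>2 / k\<close>, which cannot exceed
          \<open>1 / real (Suc i)\<close> because \<open>z i\<close> is already that close to the
          infimum \<open>d\<close>.\<close>
        define c where "c = - cnj p / complex_of_real k"
        have "d \<le> (l2norm (\<lambda>n. c * s n + z i n))\<^sup>2"
        proof (rule d_le')
          show "(\<lambda>n. (- c) * s n + w i n) \<in> S" by (intro S(3) s w)
        qed (simp add: z_def algebra_simps)
        also have "\<dots> = (cmod c)\<^sup>2 * k + 2 * Re (c * p) + (l2norm (z i))\<^sup>2"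
          unfolding l2norm_lincomb_power2[OF sl2 z] by (simp add: k_def p_def)
        also have "(cmod c)\<^sup>2 * k = (cmod p)\<^sup>2 / k"
          using k by (simp add: c_def norm_divide power_divide power2_eq_square)
        also have "Re (c * p) = - ((cmod p)\<^sup>2 / k)"
        proof -
          have "c * p = - complex_of_real ((cmod p)\<^sup>2 / k)"
            unfolding c_def of_real_divide complex_norm_square by simp
          then show ?thesis by simp
        qed
        finally have "(cmod p)\<^sup>2 / k \<le> 1 / real (Suc i)"
          using z_less[of i] by simp
        then show ?thesis
          using k by (simp add: p_def field_simps)
      qed
      have "(\<lambda>i. (cmod (inner_l2 (z i) s))\<^sup>2) \<longlonglongrightarrow> (cmod (inner_l2 x s))\<^sup>2"
        by (intro tendsto_intros inner_tendsto_left[OF x z sl2 lim])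
      moreover have "(\<lambda>i. (cmod (inner_l2 (z i) s))\<^sup>2) \<longlonglongrightarrow> 0"
      proof (rule tendsto_sandwich[OF _ _ tendsto_const])
        show "(\<lambda>i. k / real (Suc i)) \<longlonglongrightarrow> 0"
          using LIMSEQ_Suc[OF lim_const_over_n[of k]] by simp
      qed (use small in auto)
      ultimately have "(cmod (inner_l2 x s))\<^sup>2 = 0"
        by (rule LIMSEQ_unique)
      then show ?thesis by simp
    qed
  qed
  have "\<exists>m. x m \<noteq> 0"
  proof (rule ccontr)
    \<comment> \<open>If the limit were zero, \<open>w i\<close> would tend to \<open>u\<close>,
      placing \<open>u\<close> in the closure of \<open>S\<close>.\<close>
    assume "\<not> (\<exists>m. x m \<noteq> 0)"
    then have "(\<lambda>i. l2norm (z i)) \<longlonglongrightarrow> 0" using lim by simp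
    have "\<exists>w\<in>S. l2norm (\<lambda>n. u n - w n) < e" if "e > 0" for e
    proof -
      from LIMSEQ_D[OF \<open>(\<lambda>i. l2norm (z i)) \<longlonglongrightarrow> 0\<close> that]
      obtain i where "norm (l2norm (z i) - 0) < e" by blast
      then have "l2norm (\<lambda>n. u n - w i n) < e" by (simp add: z_def)
      then show ?thesis using w by blast
    qed
    then have "u \<in> l2_closure S" using u(1) by (simp add: l2_closure_def)
    then show False using u(2) by simp
  qed
  with x show ?thesis using orth by (rule that)
qed

lemma bop_range_orthogonal:
  assumes A: "bop A" and ns: "support A \<noteq> l2"
  obtains v where "v \<in> l2" "\<exists>m. v m \<noteq> 0" "\<And>w. w \<in> l2 \<Longrightarrow> inner_l2 v (A w) = 0"
proof -
  have "support A \<subseteq> l2" by (auto simp: support_def l2_closure_def)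
  with ns obtain u where u: "u \<in> l2" "u \<notin> l2_closure (A ` l2)"
    by (auto simp: support_def)
  show ?thesis
  proof (rule not_dense_imp_orthogonal[OF _ _ _ u])
    show "A ` l2 \<subseteq> l2" using bop_l2[OF A] by blast
    show "(\<lambda>n. 0) \<in> A ` l2" using bop_zero[OF A] l2_zero by (metis image_eqI)
    fix c a b assume "a \<in> A ` l2" "b \<in> A ` l2"
    then obtain a' b' where "a' \<in> l2" "b' \<in> l2" "a = A a'" "b = A b'" by blast
    then have "(\<lambda>n. c * a n + b n) = A (\<lambda>n. c * a' n + b' n)" "(\<lambda>n. c * a' n + b' n) \<in> l2"
      by (simp_all add: bop_lincomb[OF A] l2_lincomb)
    then show "(\<lambda>n. c * a n + b n) \<in> A ` l2"
      by (rule image_eqI)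
  qed (use that in blast)
qed

section \<open>Rank-one operators \<open>|v><v|\<close>, with \<open>v\<close> not
  normalised\<close>

definition rank_one :: "vec \<Rightarrow> op" where
  "rank_one v u = (\<lambda>n. inner_l2 v u * v n)"

lemma inner_rank_one:
  assumes "v \<in> l2" "u \<in> l2"
  shows "inner_l2 u (rank_one v u) = complex_of_real ((cmod (inner_l2 v u))\<^sup>2)"
  unfolding rank_one_def inner_scale_right[OF assms(2,1)] complex_norm_square inner_cnj[OF assms] ..

lemma pos_op_rank_one:
  assumes v: "v \<in> l2"
  shows "pos_op (rank_one v)"
proof -
  have "bop (rank_one v)"
    unfolding bop_def
  proof (intro conjI ballI allI exI)
    fix u w c assume "u \<in> l2" "w \<in> l2"
    then show "rank_one v (\<lambda>n. c * u n + w n) = (\<lambda>n. c * rank_one v u n + rank_one v w n)"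
      using v by (simp add: rank_one_def inner_lincomb_right) (simp add: algebra_simps)
  next
    fix u assume u: "u \<in> l2"
    show "rank_one v u \<in> l2" unfolding rank_one_def by (rule l2_scale[OF v])
    have "l2norm (rank_one v u) = cmod (inner_l2 v u) * l2norm v"
      unfolding rank_one_def by (rule l2norm_scale[OF v])
    also have "\<dots> \<le> (l2norm v * l2norm u) * l2norm v"
      by (intro mult_right_mono l2_Cauchy_Schwarz v u) (use v in simp)
    also have "\<dots> = (l2norm v * l2norm v) * l2norm u" by simp
    finally show "l2norm (rank_one v u) \<le> (l2norm v * l2norm v) * l2norm u" .
  qed
  then show ?thesis
    by (simp add: pos_op_def inner_rank_one[OF v])
qed

text \<open>Column \<open>n\<close> of the product is \<open>cnj (v n)\<close> times
  \<open>A v\<close>, so the diagonal entries are the terms of the inner product of \<open>v\<close>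
  with \<open>A v\<close>.\<close>

lemma trace_comp_rank_one:
  assumes A: "bop A" and v: "v \<in> l2"
  shows "trace (A \<circ> rank_one v) = inner_l2 v (A v)"
  unfolding trace_def inner_l2_def[of v] by (simp add: rank_one_def bop_scale[OF A v])

section \<open>Cholesky factorisation of positive operators\<close>

text \<open>If the pivot is \<open>0\<close>, division by \<open>0\<close> makes this the zero vector, as required for a zero column.\<close>
definition chol_vec :: "op \<Rightarrow> nat \<Rightarrow> vec" where
  "chol_vec A k = (\<lambda>n. complex_of_real (1 / sqrt (Re (A (basis k) k))) * A (basis k) n)"

text \<open>The Schur complement of \<open>A\<close> with respect to its \<open>k\<close>-th
  diagonal entry.\<close>

definition chol_step :: "op \<Rightarrow> nat \<Rightarrow> op" where
  "chol_step A k = (\<lambda>u n. A u n - rank_one (chol_vec A k) u n)"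

primrec chol :: "op \<Rightarrow> nat \<Rightarrow> op" where
  "chol A 0 = A"
| "chol A (Suc k) = chol_step (chol A k) k"

lemma bop_lincomb_op:
  assumes A: "bop A" and B: "bop B"
  shows "bop (\<lambda>u n. c * A u n + B u n)"
proof -
  obtain C where C: "C \<ge> 0" "\<And>u. u \<in> l2 \<Longrightarrow> l2norm (A u) \<le> C * l2norm u"
    by (rule bop_bound[OF A]) blast
  obtain D where D: "D \<ge> 0" "\<And>u. u \<in> l2 \<Longrightarrow> l2norm (B u) \<le> D * l2norm u"
    by (rule bop_bound[OF B]) blast
  show ?thesis
    unfolding bop_def
  proof (intro conjI ballI allI exI)
    fix u assume u: "u \<in> l2"
    show "(\<lambda>n. c * A u n + B u n) \<in> l2"
      by (intro l2_lincomb bop_l2[OF A] bop_l2[OF B] u)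
    have "l2norm (\<lambda>n. c * A u n + B u n) \<le> cmod c * l2norm (A u) + l2norm (B u)"
      using l2norm_triangle[OF l2_scale[OF bop_l2[OF A u]] bop_l2[OF B u], of c]
      by (simp add: l2norm_scale[OF bop_l2[OF A u]])
    also have "\<dots> \<le> cmod c * (C * l2norm u) + D * l2norm u"
      by (intro add_mono mult_left_mono C D u) simp
    finally show "l2norm (\<lambda>n. c * A u n + B u n) \<le> (cmod c * C + D) * l2norm u"
      by (simp add: algebra_simps)
  next
    fix u w d assume "u \<in> l2" "w \<in> l2"
    then show "(\<lambda>n. c * A (\<lambda>n. d * u n + w n) n + B (\<lambda>n. d * u n + w n) n) =
        (\<lambda>n. d * (c * A u n + B u n) + (c * A w n + B w n))"
      by (simp add: bop_lincomb[OF A] bop_lincomb[OF B]) (simp add: algebra_simps)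
  qed
qed

lemma pos_op_entry:
  assumes A: "pos_op A"
  shows "A (basis k) n = cnj (A (basis n) k)"
  using pos_op_hermitian[OF A, of "basis n" "basis k"] by simp

lemma chol_vec_in_l2: "pos_op A \<Longrightarrow> chol_vec A k \<in> l2"
  unfolding chol_vec_def by (rule l2_scale[OF bop_l2[OF pos_op_bop basis_in_l2]])

text \<open>The subtracted form at \<open>u\<close> is the squared modulus of
  \<open>inner_l2 u (A (basis k))\<close> divided by the pivot; Cauchy-Schwarz for \<open>A\<close>
  bounds it by the form of \<open>A\<close> at \<open>u\<close>.\<close>

lemma pos_op_chol_step:
  assumes A: "pos_op A"
  shows "pos_op (chol_step A k)"
proof -
  note bA = pos_op_bop[OF A]
  define w a where "w = chol_vec A k" and "a = Re (A (basis k) k)"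
  have w: "w \<in> l2" unfolding w_def by (rule chol_vec_in_l2[OF A])
  have a: "a \<ge> 0" using pos_op_nonneg[OF A, of "basis k"] by (simp add: a_def)
  have step: "chol_step A k = (\<lambda>u n. (-1) * rank_one w u n + A u n)"
    by (simp add: chol_step_def w_def)
  have bop: "bop (chol_step A k)"
    unfolding step by (intro bop_lincomb_op bA pos_op_bop[OF pos_op_rank_one] w)
  have form: "inner_l2 u (chol_step A k u) = inner_l2 u (A u) - complex_of_real ((cmod (inner_l2 w u))\<^sup>2)"
    if u: "u \<in> l2" for u
  proof -
    show ?thesis
      unfolding step inner_rank_one[OF w u, symmetric]
      using inner_lincomb_right[OF u bop_l2[OF pos_op_bop[OF pos_op_rank_one[OF w]] u] bop_l2[OF bA u], of "-1"]
      by simp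
  qed
  have le: "(cmod (inner_l2 w u))\<^sup>2 \<le> Re (inner_l2 u (A u))" if u: "u \<in> l2" for u
  proof -
    have "inner_l2 w u = complex_of_real (1 / sqrt a) * cnj (inner_l2 u (A (basis k)))"
      unfolding w_def chol_vec_def inner_scale_left[OF u bop_l2[OF bA basis_in_l2]]
      using inner_cnj[OF u bop_l2[OF bA basis_in_l2[of k]]] by (simp add: a_def)
    \<comment> \<open>For a zero pivot both sides are \<open>0\<close>, since division by
      \<open>0\<close> gives \<open>0\<close>.\<close>
    then have "(cmod (inner_l2 w u))\<^sup>2 = (cmod (inner_l2 u (A (basis k))))\<^sup>2 / a"
      using a by (simp add: norm_mult norm_divide power_divide)
    also have "\<dots> \<le> Re (inner_l2 u (A u))"
      using pos_op_Cauchy_Schwarz[OF A basis_in_l2[of k] u] pos_op_nonneg[OF A u] a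
      by (cases "a = 0") (auto simp: a_def divide_le_eq mult.commute)
    finally show ?thesis .
  qed
  show ?thesis
    unfolding pos_op_def using bop form le pos_op_real[OF A] by simp
qed

text \<open>With a nonzero pivot the subtraction cancels column \<open>k\<close>. With a zero pivot,
  Cauchy-Schwarz shows that the column was zero already.\<close>

lemma chol_step_kills_new:
  assumes A: "pos_op A"
  shows "chol_step A k (basis k) = (\<lambda>n. 0)"
proof
  fix n
  define a where "a = Re (A (basis k) k)"
  have Akk: "A (basis k) k = complex_of_real a"
    using pos_op_real[OF A, of "basis k"] by (simp add: a_def complex_eq_iff)
  have a: "a \<ge> 0" using pos_op_nonneg[OF A, of "basis k"] by (simp add: a_def)
  show "chol_step A k (basis k) n = 0"
  proof (cases "a = 0")
    case True
    then have "(cmod (A (basis k) n))\<^sup>2 \<le> 0"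
      using pos_op_Cauchy_Schwarz[OF A, of "basis k" "basis n"] by (simp add: Akk)
    then show ?thesis by (simp add: chol_step_def rank_one_def chol_vec_def)
  next
    case False
    then have "complex_of_real (sqrt a) * complex_of_real (sqrt a) = complex_of_real a"
      using a by (simp flip: of_real_mult)
    then show ?thesis
      using False by (simp add: chol_step_def rank_one_def chol_vec_def Akk field_simps)
  qed
qed

text \<open>By hermitian symmetry a zero column \<open>j\<close> is also a zero row, so the next
  vector has no \<open>j\<close>-th coordinate and column \<open>j\<close> stays zero.\<close>

lemma chol_step_kills_old:
  assumes A: "pos_op A" and kill: "A (basis j) = (\<lambda>n. 0)"
  shows "chol_step A k (basis j) = (\<lambda>n. 0)" "chol_vec A k j = 0"
  using pos_op_entry[OF A, of k j] by (simp_all add: chol_step_def rank_one_def chol_vec_def kill)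

text \<open>After \<open>k\<close> elimination steps the first \<open>k\<close> columns are zero.
  Hence \<open>W k\<close> starts at coordinate \<open>k\<close>, and the expansion of column
  \<open>m\<close> is exact after \<open>m + 1\<close> steps, so only finite sums occur.\<close>

lemma pos_op_Cholesky:
  assumes A: "pos_op A"
  obtains W where "\<And>k. W k \<in> l2" "\<And>k j. j < k \<Longrightarrow> W k j = 0"
    "\<And>m n. A (basis m) n = (\<Sum>k\<le>m. cnj (W k m) * W k n)"
proof -
  define W where "W k = chol_vec (chol A k) k" for k
  have pos: "pos_op (chol A k)" for k
    by (induction k) (auto intro: A pos_op_chol_step)
  have kill: "j < k \<Longrightarrow> chol A k (basis j) = (\<lambda>n. 0)" for j k
  proof (induction k)
    case (Suc k)
    then show ?case
      using chol_step_kills_new[OF pos, of k] chol_step_kills_old(1)[OF pos, of k j k]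
      by (cases "j = k") auto
  qed simp
  have decomp: "A (basis m) n = (\<Sum>k<K. cnj (W k m) * W k n) + chol A K (basis m) n" for m n K
    by (induction K) (auto simp: chol_step_def rank_one_def W_def)
  show ?thesis
  proof (rule that[of W])
    show "W k \<in> l2" for k
      unfolding W_def by (rule chol_vec_in_l2[OF pos])
    show "W k j = 0" if "j < k" for k j
      unfolding W_def by (rule chol_step_kills_old(2)[OF pos kill[OF that]])
    show "A (basis m) n = (\<Sum>k\<le>m. cnj (W k m) * W k n)" for m n
      using decomp[of m n "Suc m"] kill[of m "Suc m"] by (simp add: lessThan_Suc_atMost)
  qed
qed

section \<open>The trace against a density matrix as a sum of quadratic forms\<close>

lemma has_sum_l2norm:
  assumes "u \<in> l2"
  shows "((\<lambda>n. (cmod (u n))\<^sup>2) has_sum (l2norm u)\<^sup>2) UNIV"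
  by (rule sums_nonneg_imp_has_sum)
     (use assms in \<open>auto simp: l2norm_power2 l2_def intro: summable_sums\<close>)

lemma has_sum_inner:
  assumes "v \<in> l2" "u \<in> l2"
  shows "((\<lambda>n. cnj (v n) * u n) has_sum inner_l2 v u) UNIV"
  using summable_inner[OF assms] inner_sums[OF assms] by (rule norm_summable_imp_has_sum)

text \<open>Inserting the Cholesky vectors of \<open>\<eta>\<close> turns the trace into the sum
  over \<open>k\<close> of the nonnegative numbers \<open>inner_l2 (W k) (A (W k))\<close>. A zero
  trace makes all of them zero, and some \<open>W k\<close> is nonzero because \<open>\<eta>\<close>
  has trace \<open>1\<close>.\<close>

lemma trace_comp_eq_0_imp_null_vector:
  assumes A: "pos_op A" and \<eta>: "density_matrix \<eta>" and tr: "trace (\<eta> \<circ> A) = 0"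
  obtains w where "w \<in> l2" "\<exists>n. w n \<noteq> 0" "Re (inner_l2 w (A w)) = 0"
proof -
  note bA = pos_op_bop[OF A]
  from \<eta> have pos\<eta>: "pos_op \<eta>" and summ\<eta>: "summable (\<lambda>n. \<eta> (basis n) n)" and tr\<eta>: "(\<Sum>n. \<eta> (basis n) n) = 1"
    by (auto simp: density_matrix_def trace_def)
  note b\<eta> = pos_op_bop[OF pos\<eta>]
  obtain W where W: "\<And>k. W k \<in> l2" and W0: "\<And>k j. j < k \<Longrightarrow> W k j = 0"
    and \<eta>W: "\<And>m n. \<eta> (basis m) n = (\<Sum>k\<le>m. cnj (W k m) * W k n)"
    by (rule pos_op_Cholesky[OF pos\<eta>]) blast
  obtain C where C: "C \<ge> 0" "\<And>u. u \<in> l2 \<Longrightarrow> l2norm (A u) \<le> C * l2norm u"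
    by (rule bop_bound[OF bA]) blast
  have AW: "A (W k) \<in> l2" for k by (rule bop_l2[OF bA W])

  have diag: "\<eta> (basis n) n = complex_of_real (\<Sum>k\<le>n. (cmod (W k n))\<^sup>2)" for n
    unfolding \<eta>W of_real_sum complex_norm_square by (simp add: mult.commute)
  have "summable (\<lambda>n. \<Sum>k\<le>n. (cmod (W k n))\<^sup>2)"
    using summable_Re[OF summ\<eta>] unfolding diag by simp
  then have diag_summable: "(\<lambda>n. \<Sum>k\<le>n. (cmod (W k n))\<^sup>2) summable_on UNIV"
    by (rule summable_nonneg_imp_summable_on) (auto intro: sum_nonneg)
  \<comment> \<open>Grouped by \<open>n\<close>, these squares sum to the diagonal entries of
    \<open>\<eta>\<close>, which are summable; regrouped by \<open>k\<close>, they give the squared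
    norms of the \<open>W k\<close>.\<close>
  have "(\<lambda>(n, k). (cmod (W k n))\<^sup>2) summable_on UNIV \<times> UNIV"
  proof (rule summable_on_SigmaI[OF _ diag_summable])
    show "((\<lambda>k. case (n, k) of (n, k) \<Rightarrow> (cmod (W k n))\<^sup>2) has_sum (\<Sum>k\<le>n. (cmod (W k n))\<^sup>2)) UNIV" for n
      by (rule has_sum_finite_neutralI[of "{..n}"]) (auto simp: W0)
  qed auto
  then have W_summable: "(\<lambda>(k, n). (cmod (W k n))\<^sup>2) summable_on UNIV \<times> UNIV"
    by (subst (asm) summable_on_swap) simp
  from has_sum_SigmaD[OF has_sum_infsum[OF this], of "\<lambda>k. (l2norm (W k))\<^sup>2"]
  have norms: "(\<lambda>k. (l2norm (W k))\<^sup>2) summable_on UNIV"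
    using has_sum_l2norm[OF W] by (auto intro: has_sum_imp_summable)

  have AW_norms: "(\<lambda>k. (l2norm (A (W k)))\<^sup>2) summable_on UNIV"
  proof (rule summable_on_comparison_test)
    show "(\<lambda>k. C\<^sup>2 * (l2norm (W k))\<^sup>2) summable_on UNIV"
      by (rule summable_on_cmult_right[OF norms])
    show "(l2norm (A (W k)))\<^sup>2 \<le> C\<^sup>2 * (l2norm (W k))\<^sup>2" for k
      unfolding power_mult_distrib[symmetric] by (rule power_mono[OF C(2)[OF W]]) (simp add: AW)
  qed simp
  have AW_summable: "(\<lambda>(k, n). (cmod (A (W k) n))\<^sup>2) summable_on UNIV \<times> UNIV"
    by (rule summable_on_SigmaI[OF _ AW_norms]) (auto intro: has_sum_l2norm AW)

  \<comment> \<open>Summing \<open>g\<close> over \<open>n\<close> first gives the forms at the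
    \<open>W k\<close>; summing over \<open>k\<close> first gives the diagonal of
    \<open>\<eta> \<circ> A\<close>. Absolute summability makes the two totals agree.\<close>
  define g where "g = (\<lambda>(k, n). cnj (A (W k) n) * W k n)"
  have "(\<lambda>x. norm (g x)) summable_on UNIV \<times> UNIV"
  proof (rule Infinite_Sum.abs_summable_on_comparison_test'[OF summable_on_add[OF AW_summable W_summable]])
    fix x :: "nat \<times> nat"
    obtain k n where x: "x = (k, n)" by (cases x)
    have "cmod (A (W k) n) * cmod (W k n) \<le> 2 * cmod (A (W k) n) * cmod (W k n)" by simp
    also have "\<dots> \<le> (cmod (A (W k) n))\<^sup>2 + (cmod (W k n))\<^sup>2" by (rule sum_squares_bound)
    finally show "norm (g x) \<le> (case x of (k, n) \<Rightarrow> (cmod (A (W k) n))\<^sup>2) + (case x of (k, n) \<Rightarrow> (cmod (W k n))\<^sup>2)"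
      by (simp add: x g_def norm_mult)
  qed
  then obtain S where S: "(g has_sum S) (UNIV \<times> UNIV)"
    using abs_summable_summable[of g] unfolding summable_on_def[of g] by blast
  have rows: "((\<lambda>k. inner_l2 (W k) (A (W k))) has_sum S) UNIV"
  proof (rule has_sum_SigmaD[OF S])
    show "((\<lambda>n. g (k, n)) has_sum inner_l2 (W k) (A (W k))) UNIV" for k
      using has_sum_inner[OF AW W, of k k] pos_op_hermitian[OF A W W, of k k] by (simp add: g_def)
  qed
  have "((\<lambda>(n, k). g (k, n)) has_sum S) (UNIV \<times> UNIV)"
    using S by (subst has_sum_swap) (simp add: case_prod_beta')
  then have "((\<lambda>n. inner_l2 (basis n) ((\<eta> \<circ> A) (basis n))) has_sum S) UNIV"
  proof (rule has_sum_SigmaD)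
    fix n
    \<comment> \<open>Once \<open>\<eta>\<close> is moved to the left argument,
      \<open>\<eta> (basis n)\<close> is replaced by its finite Cholesky expansion.\<close>
    have "(\<lambda>m. \<Sum>k\<le>n. W k n * (cnj (W k m) * A (basis n) m)) sums (\<Sum>k\<le>n. W k n * inner_l2 (W k) (A (basis n)))"
      by (intro sums_sum sums_mult inner_sums W bop_l2[OF bA] basis_in_l2)
    moreover have "(\<lambda>m. \<Sum>k\<le>n. W k n * (cnj (W k m) * A (basis n) m)) = (\<lambda>m. cnj (\<eta> (basis n) m) * A (basis n) m)"
      by (simp add: \<eta>W sum_distrib_right mult.assoc)
    moreover have "(\<lambda>m. cnj (\<eta> (basis n) m) * A (basis n) m) sums inner_l2 (\<eta> (basis n)) (A (basis n))"
      by (intro inner_sums bop_l2[OF bA] bop_l2[OF b\<eta>] basis_in_l2)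
    ultimately have "inner_l2 (\<eta> (basis n)) (A (basis n)) = (\<Sum>k\<le>n. W k n * inner_l2 (W k) (A (basis n)))"
      by (simp add: sums_iff)
    also have "\<dots> = (\<Sum>k\<le>n. g (k, n))"
      by (simp add: g_def pos_op_hermitian[OF A W basis_in_l2] mult.commute)
    finally have "inner_l2 (basis n) ((\<eta> \<circ> A) (basis n)) = (\<Sum>k\<le>n. g (k, n))"
      using pos_op_hermitian[OF pos\<eta> basis_in_l2[of n] bop_l2[OF bA basis_in_l2[of n]]] by simp
    moreover have "((\<lambda>k. g (k, n)) has_sum (\<Sum>k\<le>n. g (k, n))) UNIV"
      by (rule has_sum_finite_neutralI[of "{..n}"]) (auto simp: g_def W0)
    ultimately show "((\<lambda>k. case (n, k) of (n, k) \<Rightarrow> g (k, n)) has_sum inner_l2 (basis n) ((\<eta> \<circ> A) (basis n))) UNIV"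
      by simp
  qed
  then have "S = 0"
    using tr unfolding trace_def by (auto dest: has_sum_imp_sums simp: sums_iff)
  with rows have "(\<lambda>k. inner_l2 (W k) (A (W k))) sums 0"
    by (simp add: has_sum_imp_sums)
  then have "(\<lambda>k. Re (inner_l2 (W k) (A (W k)))) sums 0"
    using sums_Re by fastforce
  then have null: "Re (inner_l2 (W k) (A (W k))) = 0" for k
    using suminf_eq_zero_iff[of "\<lambda>k. Re (inner_l2 (W k) (A (W k)))"] pos_op_nonneg[OF A W]
    by (auto simp: sums_iff)
  have "\<exists>k n. W k n \<noteq> 0"
  proof (rule ccontr)
    assume "\<nexists>k n. W k n \<noteq> 0"
    then have "\<eta> (basis n) n = 0" for n by (simp add: diag)
    then show False using tr\<eta> by simp
  qed
  then show ?thesis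
    using null W that by blast
qed

section \<open>Uniqueness for exponential series\<close>

text \<open>
  Analytic continuation in the sector \<open>K \<bar>Im z\<bar> < Re z\<close> extends the zeros to all of \<open>(0, \<infinity>)\<close>;
  for large \<open>s\<close> the first nonzero coefficient would dominate.
\<close>
lemma exp_series_eq_0_imp_coeffs_0:
  fixes a d :: "nat \<Rightarrow> complex" and x K :: real
  assumes summ: "summable (\<lambda>n. cmod (a n))"
    and K: "K \<ge> 0" and sector: "\<And>n. \<bar>Im (d n)\<bar> \<le> K * (- Re (d n))"
    and Re_d: "\<And>n. Re (d n) \<le> 0" "\<And>n. Re (d (Suc n)) < Re (d n)"
    and x: "x > 0" "complex_of_real x islimpt complex_of_real ` U" "U \<subseteq> {0<..}"
    and zero: "\<And>s. s \<in> U \<Longrightarrow> (\<Sum>n. a n * exp (complex_of_real s * d n)) = 0"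
  shows "a m = 0"
proof -
  \<comment> \<open>The sector is written as an intersection of two half-planes, which yields
    openness and convexity at once.\<close>
  define S where "S = {z. inner (Complex (-1) K) z < 0} \<inter> {z. inner (Complex (-1) (-K)) z < 0}"
  have S_iff: "z \<in> S \<longleftrightarrow> K * \<bar>Im z\<bar> < Re z" for z
    using K by (auto simp: S_def inner_complex_def abs_if mult_nonneg_nonpos mult_nonneg_nonneg
        dest: mult_nonneg_nonneg[of K "- Im z"] mult_nonneg_nonneg[of K "Im z"])
  have "open S" unfolding S_def by (intro open_Int open_halfspace_lt)
  have "connected S" unfolding S_def by (intro convex_connected convex_Int convex_halfspace_lt)
  have real_S: "complex_of_real s \<in> S" if "s > 0" for s
    using that by (simp add: S_iff)
  define F where "F z = (\<Sum>n. a n * exp (z * d n))" for z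
  \<comment> \<open>In the sector every exponential has modulus at most \<open>1\<close>: the
    contribution of \<open>Im z\<close> to the exponent is at most
    \<open>K * \<bar>Im z\<bar> * (- Re (d n))\<close>, less than the decay from \<open>Re z\<close>
    can absorb.\<close>
  have bound: "norm (a n * exp (z * d n)) \<le> cmod (a n)" if z: "z \<in> S" for n z
  proof -
    have "- (Im z * Im (d n)) \<le> \<bar>Im z\<bar> * \<bar>Im (d n)\<bar>"
      unfolding abs_mult[symmetric] by simp
    also have "\<dots> \<le> \<bar>Im z\<bar> * (K * (- Re (d n)))"
      by (intro mult_left_mono sector) simp
    finally have "Re (z * d n) \<le> (Re z - K * \<bar>Im z\<bar>) * Re (d n)"
      by (simp add: algebra_simps)
    also have "\<dots> \<le> 0"
      using z Re_d(1)[of n] by (intro mult_nonneg_nonpos) (auto simp: S_iff)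
    finally show ?thesis
      by (simp add: norm_mult mult_left_le)
  qed
  have unif: "uniform_limit S (\<lambda>N z. \<Sum>n<N. a n * exp (z * d n)) F sequentially"
    unfolding F_def by (rule Weierstrass_m_test[OF bound summ])
  have "F holomorphic_on S"
  proof (rule holomorphic_uniform_sequence[OF \<open>open S\<close>])
    show "(\<lambda>z. \<Sum>n<N. a n * exp (z * d n)) holomorphic_on S" for N
      by (intro holomorphic_intros)
    fix z assume "z \<in> S"
    then obtain r where "r > 0" "cball z r \<subseteq> S"
      using \<open>open S\<close> open_contains_cball by blast
    then show "\<exists>r>0. cball z r \<subseteq> S \<and>
        uniform_limit (cball z r) (\<lambda>N z. \<Sum>n<N. a n * exp (z * d n)) F sequentially"
      using uniform_limit_on_subset[OF unif] by blast
  qed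
  have F0: "F (complex_of_real s) = 0" if "s > 0" for s
  proof (rule analytic_continuation[OF \<open>F holomorphic_on S\<close> \<open>open S\<close> \<open>connected S\<close> _ real_S[OF x(1)] x(2)])
    show "complex_of_real ` U \<subseteq> S" using x(3) real_S by auto
    show "F z = 0" if "z \<in> complex_of_real ` U" for z
      using that zero by (auto simp: F_def)
    show "complex_of_real s \<in> S" using that by (rule real_S)
  qed
  have mono: "Re (d (n + k)) \<le> Re (d n)" for n k
    by (induction k) (auto intro: order_trans[OF less_imp_le[OF Re_d(2)]])
  show "a m = 0"
  proof (induction m rule: less_induct)
    case (less m)
    define \<delta> where "\<delta> = Re (d m) - Re (d (Suc m))"
    have \<delta>: "\<delta> > 0" using Re_d(2) by (simp add: \<delta>_def)
    define C where "C = (\<Sum>n. cmod (a (n + Suc m)))"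
    have summ': "summable (\<lambda>n. cmod (a (n + Suc m)))"
      using summ by (subst summable_iff_shift)
    \<comment> \<open>With the earlier coefficients gone, term \<open>m\<close> equals minus the
      tail, and the tail is smaller by the factor \<open>exp (- (\<delta> * s))\<close>.\<close>
    have le: "cmod (a m) \<le> C * exp (- (\<delta> * s))" if s: "s > 0" for s
    proof -
      let ?t = "\<lambda>n. a n * exp (complex_of_real s * d n)"
      have t: "summable ?t"
        by (rule summable_comparison_test'[OF summ]) (rule bound[OF real_S[OF s]])
      have "0 = (\<Sum>n. ?t (n + Suc m)) + (\<Sum>n<Suc m. ?t n)"
        using F0[OF s] suminf_split_initial_segment[OF t, of "Suc m"] by (simp add: F_def)
      also have "(\<Sum>n<Suc m. ?t n) = ?t m"
        using less by simp
      finally have tm: "?t m = - (\<Sum>n. ?t (n + Suc m))"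
        unfolding eq_neg_iff_add_eq_0 by (simp only: add.commute)
      have "cmod (?t m) = cmod (\<Sum>n. ?t (n + Suc m))"
        unfolding tm by (rule norm_minus_cancel)
      also have "\<dots> \<le> (\<Sum>n. cmod (a (n + Suc m)) * exp (s * Re (d (Suc m))))"
      proof (rule norm_suminf_le)
        show "summable (\<lambda>n. cmod (a (n + Suc m)) * exp (s * Re (d (Suc m))))"
          by (rule summable_mult2[OF summ'])
        show "norm (?t (n + Suc m)) \<le> cmod (a (n + Suc m)) * exp (s * Re (d (Suc m)))" for n
          using mono[of "Suc m" n] s by (auto simp: norm_mult add.commute intro!: mult_left_mono)
      qed
      also have "\<dots> = C * exp (s * Re (d (Suc m)))"
        unfolding C_def by (rule suminf_mult2[OF summ', symmetric])
      finally have "cmod (a m) * exp (s * Re (d m)) \<le> C * exp (s * Re (d (Suc m)))"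
        by (simp add: norm_mult)
      also have "exp (s * Re (d (Suc m))) = exp (- (\<delta> * s)) * exp (s * Re (d m))"
        by (simp add: \<delta>_def algebra_simps flip: exp_add)
      finally show ?thesis by simp
    qed
    have "((\<lambda>s. exp (- (\<delta> * s))) \<longlongrightarrow> 0) at_top"
      using \<delta> by real_asymp
    then have "((\<lambda>s. C * exp (- (\<delta> * s))) \<longlongrightarrow> C * 0) at_top"
      by (rule tendsto_mult_left)
    then have "cmod (a m) \<le> C * 0"
      by (rule tendsto_lowerbound[OF _ eventually_mono[OF eventually_gt_at_top[of 0] le]]) simp_all
    then show ?case by simp
  qed
qed

section \<open>Null vectors of the semigroup\<close>

definition trunc :: "nat \<Rightarrow> vec \<Rightarrow> vec" where
  "trunc j u = (\<lambda>n. if n < j then u n else 0)"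

lemma trunc_in_l2: "trunc j u \<in> l2"
  by (rule l2_finite_support[of j]) (simp add: trunc_def)

lemma trunc_in_domG: "trunc j u \<in> domG"
  unfolding domG_def mem_Collect_eq
proof
  show "summable (\<lambda>n. real n ^ 4 * (cmod (trunc j u n))\<^sup>2)"
    by (rule summable_finite[of "{..<j}"]) (auto simp: trunc_def)
qed (rule trunc_in_l2)

lemma trunc_tendsto:
  assumes u: "u \<in> l2"
  shows "(\<lambda>j. l2norm (\<lambda>n. trunc j u n - u n)) \<longlonglongrightarrow> 0"
proof -
  define f where "f n = (cmod (u n))\<^sup>2" for n
  have f: "summable f" using u by (simp add: f_def[abs_def] l2_def)
  have "(l2norm (\<lambda>n. trunc j u n - u n))\<^sup>2 = suminf f - (\<Sum>n<j. f n)" for j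
  proof -
    have "(\<lambda>n. f n - (if n \<in> {..<j} then f n else 0)) sums (suminf f - (\<Sum>n\<in>{..<j}. f n))"
      by (intro sums_diff summable_sums[OF f] sums_If_finite_set) simp
    moreover have "(\<lambda>n. f n - (if n \<in> {..<j} then f n else 0)) = (\<lambda>n. (cmod (trunc j u n - u n))\<^sup>2)"
      by (auto simp: trunc_def f_def)
    ultimately show ?thesis
      unfolding l2norm_power2[OF l2_diff[OF trunc_in_l2 u]] by (simp add: sums_iff)
  qed
  moreover have "(\<lambda>j. suminf f - (\<Sum>n<j. f n)) \<longlonglongrightarrow> suminf f - suminf f"
    by (intro tendsto_intros summable_LIMSEQ f)
  ultimately have "(\<lambda>j. sqrt ((l2norm (\<lambda>n. trunc j u n - u n))\<^sup>2)) \<longlonglongrightarrow> sqrt 0"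
    by (intro tendsto_real_sqrt) simp
  then show ?thesis
    by (simp add: l2_diff[OF trunc_in_l2 u])
qed

lemma l2_mult_bounded:
  assumes u: "u \<in> l2" and c: "\<And>n. (cmod (c n))\<^sup>2 \<le> C"
  shows "(\<lambda>n. c n * u n) \<in> l2"
  unfolding l2_def mem_Collect_eq
proof (rule summable_comparison_test')
  show "summable (\<lambda>n. C * (cmod (u n))\<^sup>2)"
    using u by (intro summable_mult) (simp add: l2_def)
  show "norm ((cmod (c n * u n))\<^sup>2) \<le> C * (cmod (u n))\<^sup>2" for n
    by (simp add: norm_mult power_mult_distrib mult_right_mono[OF c])
qed

lemma l2_shift_left: "u \<in> l2 \<Longrightarrow> (\<lambda>n. u (n + 1)) \<in> l2"
  unfolding l2_def mem_Collect_eq by (rule summable_ignore_initial_segment)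

lemma l2_shift_right: "u \<in> l2 \<Longrightarrow> (\<lambda>n. if n = 0 then 0 else u (n - 1)) \<in> l2"
  unfolding l2_def mem_Collect_eq by (subst summable_Suc_iff[symmetric]) simp

lemma mult_exp_le:
  fixes c w :: real
  assumes "c > 0"
  shows "w * exp (- (c * w)) \<le> 1 / c"
proof -
  have "c * w \<le> exp (c * w)"
    using exp_ge_add_one_self[of "c * w"] by linarith
  then have "c * w * exp (- (c * w)) \<le> exp (c * w) * exp (- (c * w))"
    by (rule mult_right_mono) simp
  then show ?thesis
    using assms by (simp add: field_simps flip: exp_add)
qed

section \<open>The weights \<open>omega\<close> and the eigenvalues of the generator\<close>

lemma omega_Suc: "omega r (Suc n) = (real n + 1) * (real n + r)"
  by (simp add: omega_def algebra_simps)

lemma omega_Suc_pos: "r > 0 \<Longrightarrow> omega r (Suc n) > 0"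
  unfolding omega_Suc by (intro mult_pos_pos) auto

text \<open>For \<open>r < 1\<close> the factor \<open>n + r - 1\<close> is negative at
  \<open>n = 0\<close>, but there the other factor is \<open>0\<close>.\<close>

lemma omega_nonneg: "r > 0 \<Longrightarrow> omega r n \<ge> 0"
  using omega_Suc_pos[of r "n - 1"] by (cases n) (auto simp: omega_def)

lemma Re_gval: "Re (gval r lam mu zp zm n) = - (lam\<^sup>2 / 2 * omega r (n + 1) + mu\<^sup>2 / 2 * omega r n)"
  by (simp add: gval_def)

text \<open>These differences are the exponents of the series met below. They are affine in
  \<open>n\<close>, with real parts dropping by \<open>lam\<^sup>2 + mu\<^sup>2\<close> at each
  step.\<close>

lemma gval_diff:
  "gval r lam mu zp zm (n + 1) - gval r lam mu zp zm n =
    - (Complex (lam\<^sup>2 / 2) zp * complex_of_real (2 * real n + 2 + r)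
      + Complex (mu\<^sup>2 / 2) zm * complex_of_real (2 * real n + r))"
  by (simp add: gval_def omega_def complex_eq_iff algebra_simps add_divide_distrib)

text \<open>A set of full measure in the interval meets each piece just to the right of
  \<open>t / 2\<close>; reflecting \<open>s\<close> to \<open>t - s\<close> gives points near
  \<open>t / 2\<close> and distinct from it.\<close>

lemma AE_interval_islimpt:
  assumes t: "t > 0" and AE: "AE s in lborel. 0 < s \<and> s < t \<longrightarrow> Q s"
  shows "complex_of_real (t / 2) islimpt complex_of_real ` {\<tau>. 0 < \<tau> \<and> \<tau> < t \<and> Q (t - \<tau>)}"
  unfolding islimpt_approachable
proof (intro allI impI)
  fix e :: real assume e: "e > 0"
  define b where "b = min t (t / 2 + e)"
  have b: "t / 2 < b" using t e by (simp add: b_def)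
  have "\<exists>s. t / 2 < s \<and> s < b \<and> Q s"
  proof (rule ccontr)
    assume nex: "\<nexists>s. t / 2 < s \<and> s < b \<and> Q s"
    have "AE s in lborel. s \<notin> {t / 2<..<b}"
      using AE by eventually_elim (use nex t in \<open>auto simp: b_def\<close>)
    then have "{t / 2<..<b} \<in> null_sets lborel"
      by (subst AE_iff_null_sets) auto
    then have "emeasure lborel {t / 2<..<b} = 0" by (rule null_setsD1)
    then show False using b by simp
  qed
  then obtain s where s: "t / 2 < s" "s < b" "Q s" by blast
  show "\<exists>z\<in>complex_of_real ` {\<tau>. 0 < \<tau> \<and> \<tau> < t \<and> Q (t - \<tau>)}. z \<noteq> complex_of_real (t / 2) \<and>
      dist z (complex_of_real (t / 2)) < e"
  proof (intro bexI conjI)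
    show "complex_of_real (t - s) \<in> complex_of_real ` {\<tau>. 0 < \<tau> \<and> \<tau> < t \<and> Q (t - \<tau>)}"
      using s t by (intro imageI) (auto simp: b_def)
    show "complex_of_real (t - s) \<noteq> complex_of_real (t / 2)"
      using s unfolding of_real_eq_iff by simp
    show "dist (complex_of_real (t - s)) (complex_of_real (t / 2)) < e"
      using s unfolding dist_of_real by (simp add: dist_real_def b_def abs_if)
  qed
qed

lemma AE_interval_ex:
  assumes t: "t > (0::real)" and AE: "AE s in lborel. 0 < s \<and> s < t \<longrightarrow> Q s"
  obtains s where "0 < s" "s < t" "Q s"
proof -
  have "complex_of_real (t / 2) islimpt complex_of_real ` {\<tau>. 0 < \<tau> \<and> \<tau> < t \<and> Q (t - \<tau>)}"
    by (rule AE_interval_islimpt[OF t AE])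
  then have "{\<tau>. 0 < \<tau> \<and> \<tau> < t \<and> Q (t - \<tau>)} \<noteq> {}"
    by (metis image_empty islimpt_EMPTY)
  then obtain \<tau> where "0 < \<tau>" "\<tau> < t" "Q (t - \<tau>)" by blast
  then show ?thesis using that[of "t - \<tau>"] by simp
qed

section \<open>Smoothing by \<open>P\<close> and the integral equation for rank-one
  observables\<close>

locale qds =
  fixes r lam mu zp zm :: real and T :: "real \<Rightarrow> op \<Rightarrow> op"
  assumes r: "r > 0" and lam: "lam > 0" and mu: "mu > 0"
    and sol: "qds_solution r lam mu zp zm T"
begin

abbreviation g where "g \<equiv> gval r lam mu zp zm"
abbreviation P where "P \<equiv> Psg r lam mu zp zm"
abbreviation L where "L \<equiv> Lop r lam mu"

lemma L1_P: "L 1 (P \<tau> u) n = complex_of_real (mu * sqrt (omega r (n + 1))) * exp (complex_of_real \<tau> * g (n + 1)) * u (n + 1)"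
  by (simp add: Lop_def Bop_def Psg_def)

lemma L2_P: "L 2 (P \<tau> u) n = (if n = 0 then 0 else
    complex_of_real (lam * sqrt (omega r n)) * exp (complex_of_real \<tau> * g (n - 1)) * u (n - 1))"
  by (simp add: Lop_def Bplus_def Psg_def)

lemma Re_g_nonpos: "Re (g n) \<le> 0"
  unfolding Re_gval neg_le_0_iff_le
  by (intro add_nonneg_nonneg mult_nonneg_nonneg omega_nonneg[OF r]) auto

lemma P_in_l2: "\<tau> \<ge> 0 \<Longrightarrow> u \<in> l2 \<Longrightarrow> P \<tau> u \<in> l2"
  unfolding Psg_def
  by (rule l2_mult_bounded[of _ _ 1]) (auto simp: power_le_one mult_nonneg_nonpos Re_g_nonpos)

lemma cmod_sqrt_exp_square:
  assumes "w \<ge> 0"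
  shows "(cmod (complex_of_real (k * sqrt w) * exp z))\<^sup>2 = k\<^sup>2 * (w * exp (2 * Re z))"
proof -
  have "(cmod (complex_of_real (k * sqrt w) * exp z))\<^sup>2 = k\<^sup>2 * w * (exp (Re z))\<^sup>2"
    using assms by (simp add: norm_mult power_mult_distrib)
  then show ?thesis by (simp add: exp_double)
qed

text \<open>The \<open>mu\<close> part of the decay of \<open>exp (\<tau> * g n)\<close> absorbs the
  weight \<open>omega r n\<close>, as needed for \<open>L 1\<close>.\<close>

lemma weight_mu_bound:
  assumes \<tau>: "\<tau> > 0"
  shows "(cmod (complex_of_real (k * sqrt (omega r n)) * exp (complex_of_real \<tau> * g n)))\<^sup>2 \<le> k\<^sup>2 * (1 / (\<tau> * mu\<^sup>2))"
proof -
  have "omega r n * exp (2 * Re (complex_of_real \<tau> * g n)) \<le> omega r n * exp (- (\<tau> * mu\<^sup>2 * omega r n))"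
    using \<tau> omega_nonneg[OF r] by (intro mult_left_mono) (auto simp: Re_gval algebra_simps)
  also have "\<dots> \<le> 1 / (\<tau> * mu\<^sup>2)"
    using \<tau> mu by (intro mult_exp_le) simp
  finally show ?thesis
    unfolding cmod_sqrt_exp_square[OF omega_nonneg[OF r]] by (intro mult_left_mono) auto
qed

text \<open>The \<open>lam\<close> part of the decay absorbs the shifted weight
  \<open>omega r (n + 1)\<close>, as needed for \<open>L 2\<close>.\<close>

lemma weight_lam_bound:
  assumes \<tau>: "\<tau> > 0"
  shows "(cmod (complex_of_real (k * sqrt (omega r (n + 1))) * exp (complex_of_real \<tau> * g n)))\<^sup>2 \<le> k\<^sup>2 * (1 / (\<tau> * lam\<^sup>2))"
proof -
  have "omega r (n + 1) * exp (2 * Re (complex_of_real \<tau> * g n)) \<le> omega r (n + 1) * exp (- (\<tau> * lam\<^sup>2 * omega r (n + 1)))"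
    using \<tau> omega_nonneg[OF r] by (intro mult_left_mono) (auto simp: Re_gval algebra_simps)
  also have "\<dots> \<le> 1 / (\<tau> * lam\<^sup>2)"
    using \<tau> lam by (intro mult_exp_le) simp
  finally show ?thesis
    unfolding cmod_sqrt_exp_square[OF omega_nonneg[OF r]] by (intro mult_left_mono) auto
qed

lemma L_P_in_l2:
  assumes \<tau>: "\<tau> > 0" and u: "u \<in> l2" and l: "l \<in> {1, 2}"
  shows "L l (P \<tau> u) \<in> l2"
proof -
  have shift: "L 2 (P \<tau> u) = (\<lambda>n. if n = 0 then 0 else
      (\<lambda>m. complex_of_real (lam * sqrt (omega r (m + 1))) * exp (complex_of_real \<tau> * g m) * u m) (n - 1))"
    unfolding L2_P[abs_def] by auto
  have "L 2 (P \<tau> u) \<in> l2"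
    unfolding shift by (rule l2_shift_right[OF l2_mult_bounded[OF u weight_lam_bound[OF \<tau>]]])
  moreover have "L 1 (P \<tau> u) \<in> l2"
    unfolding L1_P[abs_def]
    by (rule l2_mult_bounded[OF l2_shift_left[OF u] weight_mu_bound[OF \<tau>]])
  ultimately show ?thesis using l by auto
qed

text \<open>\<open>L 1\<close> lowers indices by one and \<open>L 2\<close> raises them, so the
  cutoff moves along. For \<open>j = 0\<close> the truncated subtraction gives cutoff
  \<open>0\<close>, and both sides vanish.\<close>

lemma L_P_trunc:
  assumes "l \<in> {1, 2}"
  shows "L l (P \<tau> (trunc j u)) = trunc (if l = 1 then j - 1 else j + 1) (L l (P \<tau> u))"
proof -
  have "L 1 (P \<tau> (trunc j u)) n = trunc (j - 1) (L 1 (P \<tau> u)) n" for n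
    unfolding trunc_def L1_P by (simp add: less_diff_conv)
  moreover have "L 2 (P \<tau> (trunc j u)) n = trunc (j + 1) (L 2 (P \<tau> u)) n" for n
    unfolding trunc_def L2_P by auto
  ultimately show ?thesis using assms by auto
qed

lemma T_pos: "s \<ge> 0 \<Longrightarrow> v \<in> l2 \<Longrightarrow> pos_op (T s (rank_one v))"
  using sol[unfolded qds_solution_def, THEN conjunct2, THEN conjunct2, THEN conjunct2, THEN conjunct1]
    pos_op_rank_one by blast

text \<open>With a rank-one observable and equal vectors, all terms on the right are nonnegative, so
  a vanishing left side will force each of them to vanish.\<close>

lemma integral_identity:
  assumes t: "t \<ge> 0" and v: "v \<in> l2" and u: "u \<in> domG"
  defines "F \<equiv> \<lambda>l s. inner_l2 (L l (P (t - s) u)) (T s (rank_one v) (L l (P (t - s) u)))"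
  shows "set_integrable lborel {0..t} (F 1)" "set_integrable lborel {0..t} (F 2)"
    "inner_l2 u (T t (rank_one v) u) = complex_of_real ((cmod (inner_l2 v (P t u)))\<^sup>2)
      + (LINT s:{0..t}|lborel. F 1 s) + (LINT s:{0..t}|lborel. F 2 s)"
proof -
  have ul2: "u \<in> l2" using u by (simp add: domG_def)
  have eq: "(\<forall>l\<in>{1, 2::nat}. set_integrable lborel {0..t} (F l)) \<and>
    inner_l2 u (T t (rank_one v) u) = inner_l2 (P t u) (rank_one v (P t u))
      + (\<Sum>l\<in>{1, 2::nat}. LINT s:{0..t}|lborel. F l s)"
    unfolding F_def
    by (rule sol[unfolded qds_solution_def, THEN conjunct2, THEN conjunct2, THEN conjunct2, THEN conjunct2,
        THEN spec, of t, THEN mp, OF t, THEN spec, of "rank_one v", THEN mp,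
        OF pos_op_bop[OF pos_op_rank_one[OF v]], THEN bspec, OF u, THEN bspec, OF u])
  then show "set_integrable lborel {0..t} (F 1)" "set_integrable lborel {0..t} (F 2)" by auto
  show "inner_l2 u (T t (rank_one v) u) = complex_of_real ((cmod (inner_l2 v (P t u)))\<^sup>2)
      + (LINT s:{0..t}|lborel. F 1 s) + (LINT s:{0..t}|lborel. F 2 s)"
    using eq inner_rank_one[OF v P_in_l2[OF t ul2]] by (simp add: add.assoc)
qed

text \<open>
  The integral equation is available on \<open>domG\<close> only, so \<open>u\<close> is approximated by its truncations:
  the nonnegative integrands tend to \<open>0\<close> in \<open>L\<^sup>1\<close>, hence almost everywhere along a subsequence.
\<close>
lemma null_vector_step:
  assumes v: "v \<in> l2" and u: "u \<in> l2" and t: "t > 0"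
    and null: "Re (inner_l2 u (T t (rank_one v) u)) = 0"
  shows "inner_l2 v (P t u) = 0"
    and "l \<in> {1, 2} \<Longrightarrow> AE s in lborel. 0 < s \<and> s < t \<longrightarrow>
      Re (inner_l2 (L l (P (t - s) u)) (T s (rank_one v) (L l (P (t - s) u)))) = 0"
proof -
  define A where "A s = T s (rank_one v)" for s
  have posA: "pos_op (A s)" if "s \<ge> 0" for s
    unfolding A_def by (rule T_pos[OF that v])
  define F where "F l j s = inner_l2 (L l (P (t - s) (trunc j u))) (A s (L l (P (t - s) (trunc j u))))" for l j s
  define h where "h l j s = indicator {0..t} s * Re (F l j s)" for l j s
  define q where "q j = Re (inner_l2 (trunc j u) (A t (trunc j u)))" for j
  \<comment> \<open>The bounded form is continuous and \<open>u\<close> is null, so the left sides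
    of the identities for the truncations tend to \<open>0\<close>; every term on the right is
    squeezed along with them.\<close>
  have q_lim: "q \<longlonglongrightarrow> 0"
    using tendsto_Re[OF form_tendsto[OF pos_op_bop[OF posA] u trunc_in_l2 trunc_tendsto[OF u], of t]] null t
    by (simp add: q_def[abs_def] A_def)
  have h_nonneg: "h l j s \<ge> 0" if "l \<in> {1, 2}" for l j s
    unfolding h_def F_def L_P_trunc[OF that]
    by (auto simp: indicator_def intro!: pos_op_nonneg posA trunc_in_l2)
  have h_int: "integrable lborel (h l j)"
    and h_LINT: "Re (LINT s:{0..t}|lborel. F l j s) = integral\<^sup>L lborel (h l j)" if l: "l \<in> {1, 2}" for l j
  proof -
    have si: "set_integrable lborel {0..t} (F l j)"
      using integral_identity(1,2)[OF less_imp_le[OF t] v trunc_in_domG[of j u]] l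
      by (auto simp: F_def[abs_def] A_def)
    then have "integrable lborel (\<lambda>s. Re (indicator {0..t} s *\<^sub>R F l j s))"
      unfolding set_integrable_def by (rule integrable_Re)
    then show "integrable lborel (h l j)"
      by (simp add: h_def[abs_def])
    show "Re (LINT s:{0..t}|lborel. F l j s) = integral\<^sup>L lborel (h l j)"
      using integral_Re[OF si[unfolded set_integrable_def]]
      by (simp add: set_lebesgue_integral_def h_def[abs_def])
  qed
  have q_eq: "q j = (cmod (inner_l2 v (P t (trunc j u))))\<^sup>2 + integral\<^sup>L lborel (h 1 j) + integral\<^sup>L lborel (h 2 j)" for j
  proof -
    have "inner_l2 (trunc j u) (A t (trunc j u)) = complex_of_real ((cmod (inner_l2 v (P t (trunc j u))))\<^sup>2)
      + (LINT s:{0..t}|lborel. F 1 j s) + (LINT s:{0..t}|lborel. F 2 j s)"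
      using integral_identity(3)[OF less_imp_le[OF t] v trunc_in_domG[of j u]]
      unfolding F_def A_def .
    then show ?thesis
      using h_LINT[of 1 j] h_LINT[of 2 j] by (simp add: q_def)
  qed
  have int_nonneg: "integral\<^sup>L lborel (h l j) \<ge> 0" if "l \<in> {1, 2}" for l j
    using h_nonneg[OF that] by (intro integral_nonneg_AE) simp
  have P_trunc: "P t (trunc j u) = trunc j (P t u)" for j
    by (auto simp: Psg_def trunc_def)

  have "(\<lambda>j. (cmod (inner_l2 v (P t (trunc j u))))\<^sup>2) \<longlonglongrightarrow> 0"
  proof (rule tendsto_sandwich[OF _ _ tendsto_const q_lim])
    show "\<forall>\<^sub>F j in sequentially. (cmod (inner_l2 v (P t (trunc j u))))\<^sup>2 \<le> q j"
      using q_eq int_nonneg by (intro always_eventually) (auto simp: add_increasing2)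
  qed simp
  moreover have "(\<lambda>j. (cmod (inner_l2 v (P t (trunc j u))))\<^sup>2) \<longlonglongrightarrow> (cmod (inner_l2 v (P t u)))\<^sup>2"
  proof -
    have Pu: "P t u \<in> l2" by (rule P_in_l2) (use t u in auto)
    have "(\<lambda>j. inner_l2 (trunc j (P t u)) v) \<longlonglongrightarrow> inner_l2 (P t u) v"
      by (rule inner_tendsto_left[OF Pu trunc_in_l2 v trunc_tendsto[OF Pu]])
    from tendsto_power[OF tendsto_norm[OF this], of 2] show ?thesis
      unfolding P_trunc inner_cnj[OF v Pu, symmetric] inner_cnj[OF v trunc_in_l2, symmetric] by simp
  qed
  ultimately have "(cmod (inner_l2 v (P t u)))\<^sup>2 = 0"
    by (rule LIMSEQ_unique[symmetric])
  then show "inner_l2 v (P t u) = 0" by simp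

  assume l: "l \<in> {1, 2}"
  have "(\<lambda>j. integral\<^sup>L lborel (\<lambda>s. norm (h l j s))) \<longlonglongrightarrow> 0"
  proof (rule tendsto_sandwich[OF _ _ tendsto_const q_lim])
    have "integral\<^sup>L lborel (h l j) \<le> q j" for j
      using q_eq[of j] int_nonneg[of 1 j] int_nonneg[of 2 j] l by auto
    then show "\<forall>\<^sub>F j in sequentially. integral\<^sup>L lborel (\<lambda>s. norm (h l j s)) \<le> q j"
      using h_nonneg[OF l] by simp
  qed simp
  from tendsto_L1_AE_subseq[OF h_int[OF l] this]
  obtain \<sigma> where \<sigma>: "strict_mono \<sigma>" "AE s in lborel. (\<lambda>j. h l (\<sigma> j) s) \<longlonglongrightarrow> 0" by blast
  have "Re (inner_l2 (L l (P (t - s) u)) (A s (L l (P (t - s) u)))) = 0"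
    if s: "0 < s" "s < t" and lim: "(\<lambda>j. h l (\<sigma> j) s) \<longlonglongrightarrow> 0" for s
  proof -
    define y where "y = L l (P (t - s) u)"
    have y: "y \<in> l2" unfolding y_def using L_P_in_l2[OF _ u l] s by simp
    \<comment> \<open>The cutoff shifted by \<open>L l\<close> still tends to infinity.\<close>
    have "filterlim (\<lambda>j::nat. if l = 1 then j - 1 else j + 1) sequentially sequentially"
      by (cases "l = 1") (simp_all add: filterlim_minus_const_nat_at_top filterlim_Suc)
    from filterlim_compose[OF trunc_tendsto[OF y] this]
    have "(\<lambda>j. F l j s) \<longlonglongrightarrow> inner_l2 y (A s y)"
      unfolding F_def L_P_trunc[OF l] y_def[symmetric]
      by (intro form_tendsto[OF pos_op_bop[OF posA] y trunc_in_l2]) (use s in simp_all)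
    from tendsto_Re[OF this] have "(\<lambda>j. h l j s) \<longlonglongrightarrow> Re (inner_l2 y (A s y))"
      using s by (simp add: h_def)
    from LIMSEQ_subseq_LIMSEQ[OF this \<sigma>(1)] show ?thesis
      using LIMSEQ_unique[OF lim] by (simp add: y_def o_def)
  qed
  then show "AE s in lborel. 0 < s \<and> s < t \<longrightarrow>
      Re (inner_l2 (L l (P (t - s) u)) (T s (rank_one v) (L l (P (t - s) u)))) = 0"
    using \<sigma>(2) unfolding A_def by (auto elim: eventually_mono)
qed

text \<open>Two uses of the integral equation: for almost every \<open>s\<close>, the vector
  \<open>L 1 (P (t - s) u)\<close> is null at time \<open>s\<close>, and then \<open>P s\<close>
  maps it to a vector orthogonal to \<open>v\<close>. In the resulting exponential series,
  coefficient \<open>m\<close> carries the factors \<open>cnj (v m)\<close> and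
  \<open>u (m + 1)\<close>.\<close>

lemma null_vector_coord_base:
  assumes v: "v \<in> l2" and vm: "v m \<noteq> 0" and u: "u \<in> l2" and t: "t > 0"
    and null: "Re (inner_l2 u (T t (rank_one v) u)) = 0"
  shows "u (m + 1) = 0"
proof -
  \<comment> \<open>Writing \<open>s = t - \<tau>\<close> in \<open>exp (s * g n)\<close> leaves a
    fixed factor \<open>exp (t * g n)\<close>. Kept in \<open>y\<close>, it makes \<open>y\<close>
    square-summable in spite of the growing weight.\<close>
  define y where "y n = complex_of_real (mu * sqrt (omega r (n + 1))) * exp (complex_of_real t * g n) * u (n + 1)" for n
  define a where "a n = cnj (v n) * y n" for n
  define d where "d n = g (n + 1) - g n" for n
  \<comment> \<open>The two summands are the ratios of imaginary to real part of the coefficients in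
    \<open>gval_diff\<close>, up to sign; their sum dominates both.\<close>
  define K where "K = 2 * \<bar>zp\<bar> / lam\<^sup>2 + 2 * \<bar>zm\<bar> / mu\<^sup>2"
  define Q where "Q s \<longleftrightarrow> (\<Sum>n. a n * exp (complex_of_real (t - s) * d n)) = 0" for s
  have y: "y \<in> l2"
    unfolding y_def by (rule l2_mult_bounded[OF l2_shift_left[OF u] weight_lam_bound[OF t]])
  have "AE s in lborel. 0 < s \<and> s < t \<longrightarrow> Re (inner_l2 (L 1 (P (t - s) u)) (T s (rank_one v) (L 1 (P (t - s) u)))) = 0"
    by (rule null_vector_step(2)[OF v u t null]) simp
  then have AE_Q: "AE s in lborel. 0 < s \<and> s < t \<longrightarrow> Q s"
  proof (rule eventually_mono, intro impI)
    fix s assume "0 < s \<and> s < t \<longrightarrow> Re (inner_l2 (L 1 (P (t - s) u)) (T s (rank_one v) (L 1 (P (t - s) u)))) = 0"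
      and s: "0 < s \<and> s < t"
    then have "inner_l2 v (P s (L 1 (P (t - s) u))) = 0"
      using null_vector_step(1)[OF v L_P_in_l2[OF _ u], of "t - s" 1 s] by simp
    moreover have "cnj (v n) * P s (L 1 (P (t - s) u)) n = a n * exp (complex_of_real (t - s) * d n)" for n
    proof -
      have "exp (complex_of_real s * g n) * exp (complex_of_real (t - s) * g (n + 1)) =
          exp (complex_of_real t * g n) * exp (complex_of_real (t - s) * d n)"
        unfolding exp_add[symmetric] d_def by (simp add: algebra_simps)
      then show ?thesis
        unfolding a_def y_def Psg_def[of _ _ _ _ _ s] L1_P by (simp add: mult_ac)
    qed
    ultimately show "Q s"
      unfolding Q_def inner_l2_def by simp
  qed
  have d: "d n = - (Complex (lam\<^sup>2 / 2) zp * complex_of_real (2 * real n + 2 + r)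
      + Complex (mu\<^sup>2 / 2) zm * complex_of_real (2 * real n + r))" for n
    unfolding d_def by (rule gval_diff)
  have Re_d: "Re (d n) = - (lam\<^sup>2 / 2 * (2 * real n + 2 + r) + mu\<^sup>2 / 2 * (2 * real n + r))"
    and Im_d: "Im (d n) = - (zp * (2 * real n + 2 + r) + zm * (2 * real n + r))" for n
    by (simp_all add: d)
  have "a m = 0"
  proof (rule exp_series_eq_0_imp_coeffs_0)
    show "summable (\<lambda>n. cmod (a n))"
      unfolding a_def by (rule summable_inner[OF v y])
    show "K \<ge> 0" by (simp add: K_def)
    show "Re (d n) \<le> 0" for n
      unfolding Re_d neg_le_0_iff_le using r by (intro add_nonneg_nonneg mult_nonneg_nonneg) auto
    show "Re (d (Suc n)) < Re (d n)" for n
    proof -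
      have "Re (d n) - Re (d (Suc n)) = lam\<^sup>2 + mu\<^sup>2"
        unfolding Re_d by (simp add: field_simps)
      then show ?thesis using lam mu by (smt (verit) zero_less_power)
    qed
    show "\<bar>Im (d n)\<bar> \<le> K * (- Re (d n))" for n
    proof -
      define X Y where "X = 2 * real n + 2 + r" and "Y = 2 * real n + r"
      have XY: "X \<ge> 0" "Y \<ge> 0" using r by (auto simp: X_def Y_def)
      have "\<bar>zp\<bar> = 2 * \<bar>zp\<bar> / lam\<^sup>2 * (lam\<^sup>2 / 2)" "\<bar>zm\<bar> = 2 * \<bar>zm\<bar> / mu\<^sup>2 * (mu\<^sup>2 / 2)"
        using lam mu by simp_all
      moreover have "2 * \<bar>zp\<bar> / lam\<^sup>2 * (lam\<^sup>2 / 2) \<le> K * (lam\<^sup>2 / 2)" "2 * \<bar>zm\<bar> / mu\<^sup>2 * (mu\<^sup>2 / 2) \<le> K * (mu\<^sup>2 / 2)"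
        by (intro mult_right_mono; simp add: K_def)+
      ultimately have K: "\<bar>zp\<bar> \<le> K * (lam\<^sup>2 / 2)" "\<bar>zm\<bar> \<le> K * (mu\<^sup>2 / 2)" by linarith+
      have "\<bar>Im (d n)\<bar> \<le> \<bar>zp\<bar> * X + \<bar>zm\<bar> * Y"
        unfolding Im_d X_def[symmetric] Y_def[symmetric] abs_minus_cancel
        using XY abs_triangle_ineq[of "zp * X" "zm * Y"] by (simp add: abs_mult)
      also have "\<dots> \<le> K * (lam\<^sup>2 / 2) * X + K * (mu\<^sup>2 / 2) * Y"
        by (intro add_mono mult_right_mono K XY)
      also have "\<dots> = K * (- Re (d n))"
        unfolding Re_d X_def[symmetric] Y_def[symmetric] by (simp add: algebra_simps)
      finally show ?thesis .
    qed
    show "t / 2 > 0" using t by simp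
    show "complex_of_real (t / 2) islimpt complex_of_real ` {\<tau>. 0 < \<tau> \<and> \<tau> < t \<and> Q (t - \<tau>)}"
      by (rule AE_interval_islimpt[OF t AE_Q])
    show "(\<Sum>n. a n * exp (complex_of_real s * d n)) = 0" if "s \<in> {\<tau>. 0 < \<tau> \<and> \<tau> < t \<and> Q (t - \<tau>)}" for s
      using that by (simp add: Q_def)
  qed auto
  \<comment> \<open>All factors of \<open>a m\<close> other than \<open>u (m + 1)\<close> are
    nonzero.\<close>
  then show ?thesis
    using vm mu omega_Suc_pos[OF r, of m] by (simp add: a_def y_def)
qed

text \<open>\<open>L 1\<close> carries coordinate \<open>k + 1\<close> to \<open>k\<close>,
  \<open>L 2\<close> carries \<open>k\<close> to \<open>k + 1\<close>, and at suitable times both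
  produce null vectors again. A coordinate that vanishes on all null vectors therefore passes this
  property to its neighbours.\<close>

lemma null_vector_eq_0:
  assumes v: "v \<in> l2" and vm: "v m \<noteq> 0"
    and "u \<in> l2" "t > 0" "Re (inner_l2 u (T t (rank_one v) u)) = 0"
  shows "u k = 0"
proof -
  \<comment> \<open>All times are quantified together because each step trades nullity at
    \<open>t\<close> for nullity at some earlier time \<open>s\<close>.\<close>
  define Z where "Z k \<longleftrightarrow> (\<forall>t>0. \<forall>u\<in>l2. Re (inner_l2 u (T t (rank_one v) u)) = 0 \<longrightarrow> u k = 0)" for k
  have step: "\<exists>\<tau>. L l (P \<tau> u) k = 0"
    if "Z k" "t > 0" "u \<in> l2" "Re (inner_l2 u (T t (rank_one v) u)) = 0" "l \<in> {1, 2}" for k t u l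
  proof -
    from null_vector_step(2)[OF v that(3,2,4,5)]
    obtain s where s: "0 < s" "s < t"
      "Re (inner_l2 (L l (P (t - s) u)) (T s (rank_one v) (L l (P (t - s) u)))) = 0"
      by (rule AE_interval_ex[OF \<open>t > 0\<close>])
    moreover have "L l (P (t - s) u) \<in> l2"
      using L_P_in_l2[OF _ that(3,5)] s by simp
    ultimately have "L l (P (t - s) u) k = 0"
      using that(1) unfolding Z_def by blast
    then show ?thesis ..
  qed
  have up: "Z (k + 1)" if "Z k" for k
    unfolding Z_def
  proof (intro allI ballI impI)
    fix t u assume "t > 0" "u \<in> l2" "Re (inner_l2 u (T t (rank_one v) u)) = 0"
    from step[OF that this, of 1] show "u (k + 1) = 0"
      unfolding L1_P using mu omega_Suc_pos[OF r, of k] by auto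
  qed
  have down: "Z k" if "Z (k + 1)" for k
    unfolding Z_def
  proof (intro allI ballI impI)
    fix t u assume "t > 0" "u \<in> l2" "Re (inner_l2 u (T t (rank_one v) u)) = 0"
    from step[OF that this, of 2] show "u k = 0"
      unfolding L2_P using lam omega_Suc_pos[OF r, of k] by auto
  qed
  have Zm: "Z (m + 1)"
    unfolding Z_def using null_vector_coord_base[OF v vm] by blast
  \<comment> \<open>Descend from \<open>m + 1\<close> to \<open>0\<close>, then climb to an
    arbitrary \<open>k\<close>.\<close>
  have "Z k \<Longrightarrow> Z 0" for k
    by (induction k) (use down in auto)
  from this[OF Zm] have "Z k"
    by (induction k) (use up in auto)
  with assms(3-5) show ?thesis
    unfolding Z_def by blast
qed

end

section \<open>Full support of the evolved state\<close>

theorem theorem5p2: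
  fixes r lam mu zp zm :: real and T :: "real \<Rightarrow> op \<Rightarrow> op"
  assumes "r > 0" and "lam > 0" and "mu > 0"
    and "minimal_qds r lam mu zp zm T"
  shows "\<forall>\<eta> t \<rho>. density_matrix \<eta> \<longrightarrow> t > 0 \<longrightarrow> predual_image T t \<eta> \<rho> \<longrightarrow> support \<rho> = l2"
proof (intro allI impI)
  fix \<eta> t \<rho>
  assume \<eta>: "density_matrix \<eta>" and t: "t > 0" and pre: "predual_image T t \<eta> \<rho>"
  interpret qds r lam mu zp zm T
    using assms by unfold_locales (auto simp: minimal_qds_def)
  have b\<rho>: "bop \<rho>"
    using pre by (simp add: predual_image_def trace_class_def)
  show "support \<rho> = l2"
  proof (rule ccontr)
    assume "support \<rho> \<noteq> l2"
    then obtain v where v: "v \<in> l2" "\<exists>m. v m \<noteq> 0" and orth: "\<And>w. w \<in> l2 \<Longrightarrow> inner_l2 v (\<rho> w) = 0"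
      by (rule bop_range_orthogonal[OF b\<rho>]) blast
    from v(2) obtain m where vm: "v m \<noteq> 0" by blast
    \<comment> \<open>\<open>rank_one v\<close> is the observable that turns orthogonality of
      \<open>v\<close> to the range of \<open>\<rho>\<close> into a zero trace.\<close>
    have "trace (\<eta> \<circ> T t (rank_one v)) = trace (\<rho> \<circ> rank_one v)"
      using pre pos_op_bop[OF pos_op_rank_one[OF v(1)]] by (simp add: predual_image_def)
    also have "\<dots> = 0"
      using trace_comp_rank_one[OF b\<rho> v(1)] orth[OF v(1)] by simp
    finally obtain w where w: "w \<in> l2" "\<exists>n. w n \<noteq> 0" "Re (inner_l2 w (T t (rank_one v) w)) = 0"
      by (rule trace_comp_eq_0_imp_null_vector[OF T_pos[OF less_imp_le[OF t] v(1)] \<eta>])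
    from w(2) null_vector_eq_0[OF v(1) vm w(1) t w(3)] show False by simp
  qed
qed

end
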